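(* For every finite simple graph $G=(V,E)$, $$\eta(\mathrm{I}(G))\;\ge\;\Gamma(G),$$ where $\mathrm{I}(G)$ is the independence complex of $G$.
   Context: The independence complex $\mathrm{I}(G)$ is the simplicial complex on $V$ whose simplices are all independent sets of $G$. For a simplicial complex $Z$, $\eta(Z)=\min\{i:\tilde H^i(Z;\mathbb{R})\ne0\}+1$, where $\tilde H^i$ is reduced simplicial cohomology with real coefficients; $\eta(Z)=\infty$ if all reduced cohomology vanishes. A vector representation of $G$ is an assignment $P$ of a vector $P(v)\in\mathbb{R}^\ell$ (for some fixed $\ell$) to every $v\in V$ such that $P(u)\cdot P(v)\ge1$ whenever $u,v$ are adjacent in $G$, and $P(u)\cdot P(v)\ge0$ whenever $u,v$ are not adjacent. $P$ is identified with the matrix whose $v$-th row is $P(v)$. Let $\mathbf{1}\in\mathbb{R}^V$ be the all-ones vector. The value of $P$ is $$|P|=\min\{\alpha\cdot\mathbf{1}:\alpha\in\mathbb{R}^V,\ \alpha\ge0,\ \alpha PP^T\ge\mathbf{1}\},$$ with inequalities coordinatewise, i.e. the condition is $\sum_{v\in V}\alpha(v)P(v)\cdot P(u)\ge1$ for every $u\in V$; $|P|=\infty$ if no such $\alpha$ exists. $\Gamma(G)\in[0,\infty]$ is the supremum of $|P|$ over all vector representations $P$ of $G$ (over all $\ell$). *)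

theory Defs
  imports
    "Graph_Theory.Pair_Digraph"
    "Jordan_Normal_Form.Matrix"
    "HOL-Algebra.Elementary_Groups"
    "HOL-Library.Extended_Real"
begin

text \<open>
  A finite simple graph is a \<open>pair_graph\<close>: finite vertex set, arcs that form a symmetric,
  loop-free set of ordered pairs of vertices.  Vertices \<open>u\<close>, \<open>v\<close> are adjacent iff
  \<open>(u, v) \<in> parcs G\<close>.
\<close>

definition independent_set :: "'a pair_pre_digraph \<Rightarrow> 'a set \<Rightarrow> bool" where
  "independent_set G S \<longleftrightarrow> S \<subseteq> pverts G \<and> (\<forall>u\<in>S. \<forall>v\<in>S. (u, v) \<notin> parcs G)"

text \<open>A simplicial complex is given by its set of simplices, the empty simplex included.\<close>

definition independence_complex :: "'a pair_pre_digraph \<Rightarrow> 'a set set" where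
  "independence_complex G = {S. independent_set G S}"


section \<open>Reduced simplicial cohomology with real coefficients\<close>

text \<open>
  We use skew-symmetric cochains: an \<open>i\<close>-cochain is a real function on the ordered
  \<open>i\<close>-simplices (lists of \<open>i + 1\<close> distinct vertices spanning a simplex) that changes sign when
  two vertices are interchanged; it is extended by \<open>0\<close> to all other lists.  The empty list is the
  ordered simplex of dimension \<open>-1\<close>, so \<open>coboundary\<close> on \<open>cochains K (-1)\<close> is the augmentation
  and the resulting cohomology is reduced.
\<close>

definition ordered_simplex :: "'a set set \<Rightarrow> 'a list \<Rightarrow> bool" where
  "ordered_simplex K xs \<longleftrightarrow> distinct xs \<and> set xs \<in> K"

definition cochains :: "'a set set \<Rightarrow> int \<Rightarrow> ('a list \<Rightarrow> real) set" where
  "cochains K i = {\<phi>.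
     (\<forall>xs. \<phi> xs \<noteq> 0 \<longrightarrow> ordered_simplex K xs \<and> int (length xs) = i + 1) \<and>
     (\<forall>us a vs b ws. \<phi> (us @ a # vs @ b # ws) = - \<phi> (us @ b # vs @ a # ws))}"

definition coboundary :: "'a set set \<Rightarrow> ('a list \<Rightarrow> real) \<Rightarrow> 'a list \<Rightarrow> real" where
  "coboundary K \<phi> xs =
     (if ordered_simplex K xs
      then \<Sum>j<length xs. (- 1) ^ j * \<phi> (take j xs @ drop (Suc j) xs) else 0)"

definition cocycles :: "'a set set \<Rightarrow> int \<Rightarrow> ('a list \<Rightarrow> real) set" where
  "cocycles K i = {\<phi> \<in> cochains K i. coboundary K \<phi> = (\<lambda>_. 0)}"

definition coboundaries :: "'a set set \<Rightarrow> int \<Rightarrow> ('a list \<Rightarrow> real) set" where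
  "coboundaries K i = coboundary K ` cochains K (i - 1)"

definition cocycle_group :: "'a set set \<Rightarrow> int \<Rightarrow> ('a list \<Rightarrow> real) monoid" where
  "cocycle_group K i =
     \<lparr>carrier = cocycles K i, monoid.mult = (\<lambda>\<phi> \<psi> xs. \<phi> xs + \<psi> xs), one = (\<lambda>_. 0)\<rparr>"

text \<open>
  Only the additive group of the vector space is recorded; this suffices to say whether the
  cohomology vanishes.
\<close>

definition reduced_cohomology :: "'a set set \<Rightarrow> int \<Rightarrow> ('a list \<Rightarrow> real) set monoid" where
  "reduced_cohomology K i = cocycle_group K i Mod coboundaries K i"

text \<open>
  The index ranges over all integers, but \<open>cochains K i\<close> is zero for \<open>i < -1\<close>.
  The infimum of the empty set is \<open>\<infinity>\<close>.
\<close>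

definition eta_complex :: "'a set set \<Rightarrow> ereal" where
  "eta_complex K =
     (INF i\<in>{i. \<not> trivial_group (reduced_cohomology K i)}. ereal (real_of_int i)) + 1"


section \<open>Vector representations\<close>

definition vector_representation ::
    "'a pair_pre_digraph \<Rightarrow> nat \<Rightarrow> ('a \<Rightarrow> real vec) \<Rightarrow> bool" where
  "vector_representation G l P \<longleftrightarrow>
     (\<forall>v\<in>pverts G. P v \<in> carrier_vec l) \<and>
     (\<forall>u\<in>pverts G. \<forall>v\<in>pverts G.
        ((u, v) \<in> parcs G \<longrightarrow> P u \<bullet> P v \<ge> 1) \<and> ((u, v) \<notin> parcs G \<longrightarrow> P u \<bullet> P v \<ge> 0))"

text \<open>
  The value of a feasible linear program that is bounded below is attained, so the infimum is the
  minimum; it is \<open>\<infinity>\<close> if the program is infeasible.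
\<close>

definition representation_value :: "'a pair_pre_digraph \<Rightarrow> ('a \<Rightarrow> real vec) \<Rightarrow> ereal" where
  "representation_value G P =
     Inf {ereal (\<Sum>v\<in>pverts G. \<alpha> v) | \<alpha>.
       (\<forall>v\<in>pverts G. \<alpha> v \<ge> 0) \<and>
       (\<forall>u\<in>pverts G. (\<Sum>v\<in>pverts G. \<alpha> v * (P v \<bullet> P u)) \<ge> 1)}"

definition Gamma_graph :: "'a pair_pre_digraph \<Rightarrow> ereal" where
  "Gamma_graph G = Sup {representation_value G P | l P. vector_representation G l P}"

end

theory Submission
  imports Defs
begin

text \<open>
  Let \<open>P\<close> be a vector representation and \<open>M u v = P u \<bullet> P v\<close>; this matrix is symmetric, positive
  semidefinite and dominates the adjacency matrix entrywise.  If the reduced cohomology of the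
  independence complex is nonzero in degree \<open>n\<close>, the value of \<open>P\<close> has to be at most \<open>n + 1\<close>, that
  is, there must be \<open>\<alpha> \<ge> 0\<close> of total \<open>n + 1\<close> (up to an arbitrarily small error) with
  \<open>\<alpha> M \<ge> 1\<close>.  By linear programming duality (\<open>approximate_minimax\<close>) it is enough to find, for
  every positive weighting \<open>w\<close> of the vertices, an \<open>\<alpha>\<close> that satisfies these inequalities on
  average with respect to \<open>w\<close>.

  Such an \<open>\<alpha>\<close> comes from Hodge theory.  Weight a simplex by the product of the weights of its
  vertices.  A nonzero cohomology class has a nonzero representative \<open>\<phi>\<close> that is both closed and
  coclosed (\<open>harmonic_representative\<close>).  Expanding \<open>\<delta>\<phi> = 0\<close> over the links of the
  \<open>(n - 1)\<close>-simplices \<open>\<tau>\<close> (\<open>harmonic_identity\<close>) produces, for each \<open>\<tau>\<close>, a sum of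
  \<open>f u * f v\<close> with \<open>f u = \<phi> (u \<tau>)\<close> over the pairs of nonadjacent link vertices, because a set of
  vertices is a simplex as soon as it is independent.  Coclosedness removes the sum over all pairs,
  and what is left, the adjacent pairs, is controlled by positive semidefiniteness of \<open>M\<close>
  (\<open>link_pair_bound\<close>).  Collecting the resulting terms simplex by simplex
  (\<open>vertex_bound\<close>, \<open>harmonic_average\<close>) gives
  \<open>\<Sum>\<^sub>\<rho> w(\<rho>) \<phi>(\<rho>)\<^sup>2 (w(V) - \<Sum>\<^sub>u (M w)\<^sub>u) \<le> 0\<close>, where \<open>\<rho>\<close> runs over the \<open>n\<close>-simplices and \<open>u\<close> over
  the vertices of \<open>\<rho>\<close>.  Choosing \<open>\<rho>\<close> at random with probability proportional to
  \<open>w(\<rho>) \<phi>(\<rho>)\<^sup>2\<close>, the probabilities \<open>\<alpha> u\<close> that \<open>u\<close> belongs to \<open>\<rho>\<close> have the total \<open>n + 1\<close> and the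
  wanted average (\<open>weighted_response\<close>).
\<close>

section \<open>Orthogonal projection\<close>

text \<open>
  Gram-Schmidt for functions supported on a finite set, by induction on that set: the members of
  \<open>B\<close> vanishing at a point \<open>s\<close> form a space supported on fewer points, and \<open>B\<close> exceeds it by
  at most one dimension.
\<close>
lemma orthogonal_projection_exists:
  fixes c f :: "'b \<Rightarrow> real" and B :: "('b \<Rightarrow> real) set"
  assumes "finite S"
    and "\<And>x. x \<in> S \<Longrightarrow> c x > 0"
    and "(\<lambda>_. 0) \<in> B"
    and "\<And>a b. a \<in> B \<Longrightarrow> b \<in> B \<Longrightarrow> (\<lambda>x. a x + b x) \<in> B"
    and "\<And>r b. b \<in> B \<Longrightarrow> (\<lambda>x. r * b x) \<in> B"
    and "\<And>b x. b \<in> B \<Longrightarrow> x \<notin> S \<Longrightarrow> b x = 0"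
  shows "\<exists>p\<in>B. \<forall>b\<in>B. (\<Sum>x\<in>S. c x * (f x - p x) * b x) = 0"
  using assms
proof (induction S arbitrary: B f rule: finite_induct)
  case empty
  then show ?case by auto
next
  case (insert s S)
  define B0 where "B0 = {b \<in> B. b s = 0}"
  have proj0: "\<exists>p\<in>B0. \<forall>b\<in>B0. (\<Sum>x\<in>S. c x * (g x - p x) * b x) = 0" for g
  proof (rule insert.IH)
    show "\<And>b x. b \<in> B0 \<Longrightarrow> x \<notin> S \<Longrightarrow> b x = 0"
      using insert.prems(5) by (auto simp: B0_def) (metis insertE)
  qed (use insert.prems in \<open>auto simp: B0_def\<close>)
  obtain p0 where p0: "p0 \<in> B0" "\<And>b. b \<in> B0 \<Longrightarrow> (\<Sum>x\<in>S. c x * (f x - p0 x) * b x) = 0"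
    using proj0[of f] by blast
  show ?case
  proof (cases "B \<subseteq> B0")
    case True
    have "(\<Sum>x\<in>insert s S. c x * (f x - p0 x) * b x) = 0" if "b \<in> B" for b
      using that True p0(2)[of b] insert.hyps by (auto simp: B0_def)
    moreover have "p0 \<in> B" using p0 by (simp add: B0_def)
    ultimately show ?thesis by blast
  next
    case False
    then obtain b' where b': "b' \<in> B" "b' s \<noteq> 0" by (auto simp: B0_def)
    obtain q where q: "q \<in> B0" "\<And>b. b \<in> B0 \<Longrightarrow> (\<Sum>x\<in>S. c x * (b' x - q x) * b x) = 0"
      using proj0[of b'] by blast
    \<comment> \<open>\<open>e\<close> spans the orthogonal complement of \<open>B0\<close> in \<open>B\<close>.\<close>
    define e where "e = (\<lambda>x. b' x - q x)"
    have minus: "(\<lambda>x. a x - r * b x) \<in> B" if "a \<in> B" "b \<in> B" for a b r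
      using insert.prems(3)[OF that(1) insert.prems(4)[OF that(2), of "-r"]] by simp
    have e: "e \<in> B" "e s \<noteq> 0"
      using minus[OF b'(1), of q 1] q(1) b'(2) by (auto simp: e_def B0_def)
    define ip where "ip = (\<lambda>g h. \<Sum>x\<in>insert s S. c x * g x * h x)"
    have ip_diff: "ip (\<lambda>x. g x - r * h x) k = ip g k - r * ip h k" for g h k r
      by (simp add: ip_def sum_subtractf sum_distrib_left algebra_simps)
    have ip_comm: "ip g h = ip h g" for g h
      by (simp add: ip_def mult.commute mult.left_commute)
    have e_orth: "ip e b = 0" if "b \<in> B0" for b
      using q(2)[OF that] that insert.hyps by (simp add: ip_def e_def B0_def)
    have p0_orth: "ip (\<lambda>x. f x - p0 x) b = 0" if "b \<in> B0" for b
      using p0(2)[OF that] that insert.hyps by (simp add: ip_def B0_def)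
    have "ip e e > 0"
      unfolding ip_def
    proof (rule sum_pos2[of _ s])
      show "0 < c s * e s * e s"
        using insert.prems(1)[of s] e(2) by (auto simp: mult.assoc zero_less_mult_iff)
      show "0 \<le> c x * e x * e x" if "x \<in> insert s S" for x
        using insert.prems(1)[OF that] by (simp add: mult.assoc)
    qed (use insert.hyps in auto)
    define r where "r = ip (\<lambda>x. f x - p0 x) e / ip e e"
    define p where "p = (\<lambda>x. p0 x - (- r) * e x)"
    have "p \<in> B" unfolding p_def by (rule minus) (use p0 e in \<open>auto simp: B0_def\<close>)
    have fp: "(\<lambda>x. f x - p x) = (\<lambda>x. (f x - p0 x) - r * e x)"
      by (auto simp: p_def)
    have "ip (\<lambda>x. f x - p x) b = 0" if "b \<in> B" for b
    proof -
      define t where "t = b s / e s"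
      define b0 where "b0 = (\<lambda>x. b x - t * e x)"
      have b0: "b0 \<in> B0"
        using minus[OF that e(1), of t] e(2) by (simp add: B0_def b0_def) (simp add: t_def)
      have "ip (\<lambda>x. f x - p x) b0 = 0"
        unfolding fp ip_diff using e_orth[OF b0] p0_orth[OF b0] by simp
      moreover have "ip (\<lambda>x. f x - p x) e = 0"
        unfolding fp ip_diff using \<open>ip e e > 0\<close> by (simp add: r_def)
      moreover have "ip b0 (\<lambda>x. f x - p x) = ip b (\<lambda>x. f x - p x) - t * ip e (\<lambda>x. f x - p x)"
        unfolding b0_def by (rule ip_diff)
      ultimately show ?thesis by (simp add: ip_comm)
    qed
    then show ?thesis using \<open>p \<in> B\<close> unfolding ip_def by blast
  qed
qed

section \<open>A minimax theorem\<close>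

text \<open>
  The linear programming duality that the proof needs.  A row player mixes with total mass
  \<open>s\<close>; if every positive column weighting has a reply that does well on the weighted average,
  then some mixture does well, up to \<open>e\<close>, on all columns at once.

  The proof is a descent on the total squared deficit \<open>F\<close>.  The positive parts of the
  deficits of \<open>\<alpha>\<close>, shifted by a small \<open>\<delta>\<close> to be positive, serve as weights; moving \<open>\<alpha>\<close> a
  step \<open>t\<close> towards the reply \<open>\<beta>\<close> lowers \<open>F\<close> at first order, and the second-order term is
  bounded uniformly.  If the infimum of \<open>F\<close> were positive, every step would lower \<open>F\<close> by a
  fixed amount, and one step from a nearly optimal \<open>\<alpha>\<close> would pass below the infimum.
\<close>
lemma approximate_minimax:
  fixes M :: "'a \<Rightarrow> 'a \<Rightarrow> real" and s :: real
  assumes fin: "finite V" and "s \<ge> 0"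
    and response: "\<And>w. (\<And>v. v \<in> V \<Longrightarrow> w v > 0) \<Longrightarrow>
      \<exists>\<alpha>. (\<forall>v\<in>V. \<alpha> v \<ge> 0) \<and> sum \<alpha> V = s \<and>
          (\<Sum>v\<in>V. w v) \<le> (\<Sum>v\<in>V. w v * (\<Sum>u\<in>V. \<alpha> u * M u v))"
    and "e > 0"
  shows "\<exists>\<alpha>. (\<forall>v\<in>V. \<alpha> v \<ge> 0) \<and> sum \<alpha> V = s \<and> (\<forall>v\<in>V. (\<Sum>u\<in>V. \<alpha> u * M u v) \<ge> 1 - e)"
proof (rule ccontr)
  assume none: "\<not> ?thesis"
  define D where "D = {\<alpha>. (\<forall>v\<in>V. \<alpha> v \<ge> 0) \<and> sum \<alpha> V = s}"
  define g where "g = (\<lambda>\<alpha> v. 1 - (\<Sum>u\<in>V. \<alpha> u * M u v))"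
  define F where "F = (\<lambda>\<alpha>. \<Sum>v\<in>V. (max 0 (g \<alpha> v))\<^sup>2)"
  have resp: "\<exists>\<beta>\<in>D. (\<Sum>v\<in>V. w v * g \<beta> v) \<le> 0" if "\<And>v. v \<in> V \<Longrightarrow> w v > 0" for w
    using response[OF that] unfolding D_def g_def by (auto simp: algebra_simps sum_subtractf)
  have F_big: "F \<alpha> \<ge> e\<^sup>2" if "\<alpha> \<in> D" for \<alpha>
  proof -
    obtain v where v: "v \<in> V" "g \<alpha> v > e"
      using none \<open>\<alpha> \<in> D\<close> by (force simp: D_def g_def)
    have "e\<^sup>2 \<le> (max 0 (g \<alpha> v))\<^sup>2"
      using v \<open>e > 0\<close> by (intro power_mono) auto
    also have "\<dots> \<le> F \<alpha>"
      unfolding F_def using v(1) fin by (intro member_le_sum) auto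
    finally show ?thesis .
  qed
  \<comment> \<open>\<open>c\<close> bounds all deficits, hence by \<open>C\<close> the second-order term of a step.\<close>
  define c where "c = 1 + (\<Sum>v\<in>V. \<Sum>u\<in>V. s * \<bar>M u v\<bar>)"
  have "c \<ge> 1" unfolding c_def using \<open>s \<ge> 0\<close> by (simp add: sum_nonneg)
  have g_bound: "\<bar>g \<alpha> v\<bar> \<le> c" if "\<alpha> \<in> D" "v \<in> V" for \<alpha> v
  proof -
    have le: "\<bar>\<alpha> u\<bar> \<le> s" if "u \<in> V" for u
      using \<open>\<alpha> \<in> D\<close> member_le_sum[of u V \<alpha>] that fin by (auto simp: D_def)
    have "\<bar>\<Sum>u\<in>V. \<alpha> u * M u v\<bar> \<le> (\<Sum>u\<in>V. \<bar>\<alpha> u * M u v\<bar>)" by (rule sum_abs)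
    also have "\<dots> \<le> (\<Sum>u\<in>V. s * \<bar>M u v\<bar>)"
      using le by (intro sum_mono) (simp add: abs_mult mult_right_mono)
    also have "\<dots> \<le> (\<Sum>v\<in>V. \<Sum>u\<in>V. s * \<bar>M u v\<bar>)"
      using that fin \<open>s \<ge> 0\<close> by (intro member_le_sum[of v V "\<lambda>v. \<Sum>u\<in>V. s * \<bar>M u v\<bar>"]) (auto intro: sum_nonneg)
    finally show ?thesis unfolding g_def c_def by linarith
  qed
  define m where "m = Inf (F ` D)"
  have "D \<noteq> {}" using resp[of "\<lambda>_. 1"] by auto
  have bdd: "bdd_below (F ` D)" using F_big by (intro bdd_belowI[of _ "e\<^sup>2"]) auto
  have "m \<ge> e\<^sup>2" unfolding m_def using F_big \<open>D \<noteq> {}\<close> by (intro cInf_greatest) auto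
  then have "m > 0" using \<open>e > 0\<close> by (smt (verit) zero_less_power)
  have m_le: "m \<le> F \<alpha>" if "\<alpha> \<in> D" for \<alpha>
    unfolding m_def using bdd that by (intro cInf_lower) auto
  define N where "N = real (card V)"
  \<comment> \<open>\<open>\<delta>\<close> and \<open>t\<close> are so small that the shift of the weights and the second-order term each
      consume only part of the first-order gain, of order \<open>t * m\<close>.\<close>
  define \<delta> where "\<delta> = m / (2 * (c * N + 1))"
  define C where "C = 4 * c\<^sup>2 * N + 1"
  define t where "t = min 1 (m / (2 * C))"
  have "N \<ge> 0" by (simp add: N_def)
  have "c * N \<ge> 0" using \<open>c \<ge> 1\<close> \<open>N \<ge> 0\<close> by simp
  have "C \<ge> 1" using \<open>N \<ge> 0\<close> by (simp add: C_def)
  have "\<delta> > 0" unfolding \<delta>_def using \<open>m > 0\<close> \<open>c * N \<ge> 0\<close> by simp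
  have \<delta>: "2 * \<delta> * (c * N) \<le> m"
    unfolding \<delta>_def using \<open>m > 0\<close> \<open>c * N \<ge> 0\<close> by (simp add: field_simps)
  have t: "0 < t" "t \<le> 1" using \<open>m > 0\<close> \<open>C \<ge> 1\<close> by (auto simp: t_def)
  have tC: "t * C \<le> m / 2"
  proof -
    have "t \<le> m / (2 * C)" by (simp add: t_def)
    then show ?thesis using \<open>C \<ge> 1\<close> by (simp add: field_simps)
  qed
  have step: "\<exists>\<gamma>\<in>D. F \<gamma> \<le> F \<alpha> - t * m / 2" if \<alpha>: "\<alpha> \<in> D" for \<alpha>
  proof -
    define x where "x = (\<lambda>v. max 0 (g \<alpha> v))"
    obtain \<beta> where \<beta>: "\<beta> \<in> D" "(\<Sum>v\<in>V. (x v + \<delta>) * g \<beta> v) \<le> 0"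
      using resp[of "\<lambda>v. x v + \<delta>"] \<open>\<delta> > 0\<close> by (auto simp: x_def add_nonneg_pos)
    define y where "y = (\<lambda>v. g \<beta> v - g \<alpha> v)"
    define \<gamma> where "\<gamma> = (\<lambda>v. (1 - t) * \<alpha> v + t * \<beta> v)"
    have "\<gamma> \<in> D"
      using \<alpha> \<beta>(1) t unfolding D_def \<gamma>_def
      by (simp add: sum.distrib sum_distrib_left[symmetric]) (simp add: algebra_simps)
    have g\<gamma>: "g \<gamma> v = g \<alpha> v + t * y v" for v
      unfolding g_def y_def \<gamma>_def
      by (simp add: sum.distrib sum_subtractf sum_distrib_left algebra_simps)
    have "x v * g \<alpha> v = (x v)\<^sup>2" for v
      by (auto simp: x_def max_def power2_eq_square)
    then have xy: "(\<Sum>v\<in>V. x v * y v) = (\<Sum>v\<in>V. x v * g \<beta> v) - F \<alpha>"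
      by (simp add: y_def F_def right_diff_distrib sum_subtractf) (simp add: x_def)
    have x\<beta>: "(\<Sum>v\<in>V. x v * g \<beta> v) \<le> \<delta> * (c * N)"
    proof -
      have "(\<Sum>v\<in>V. - g \<beta> v) \<le> (\<Sum>v\<in>V. c)"
        using g_bound[OF \<beta>(1)] by (intro sum_mono) (smt (verit))
      then have "- (\<Sum>v\<in>V. g \<beta> v) \<le> c * N" by (simp add: N_def sum_negf mult.commute)
      then have "\<delta> * (- (\<Sum>v\<in>V. g \<beta> v)) \<le> \<delta> * (c * N)"
        using \<open>\<delta> > 0\<close> by (intro mult_left_mono) auto
      then show ?thesis
        using \<beta>(2) by (simp add: distrib_right sum.distrib sum_distrib_left[symmetric])
    qed
    have "F \<gamma> \<le> (\<Sum>v\<in>V. (x v)\<^sup>2 + 2 * t * (x v * y v) + t\<^sup>2 * (4 * c\<^sup>2))"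
      unfolding F_def
    proof (rule sum_mono)
      fix v assume v: "v \<in> V"
      \<comment> \<open>Replacing the deficit \<open>g \<alpha> v\<close> by its positive part \<open>x v\<close> only enlarges a positive result.\<close>
      have "(max 0 (g \<gamma> v))\<^sup>2 \<le> (x v + t * y v)\<^sup>2"
      proof (cases "g \<gamma> v \<le> 0")
        case False
        then show ?thesis
          by (intro power_mono) (auto simp: g\<gamma> x_def)
      qed auto
      moreover have "(y v)\<^sup>2 \<le> (2 * c)\<^sup>2"
        using g_bound[OF \<alpha> v] g_bound[OF \<beta>(1) v]
        by (intro power2_le_iff_abs_le[THEN iffD2]) (auto simp: y_def)
      then have "t\<^sup>2 * (y v)\<^sup>2 \<le> t\<^sup>2 * (4 * c\<^sup>2)" by (intro mult_left_mono) auto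
      ultimately show "(max 0 (g \<gamma> v))\<^sup>2 \<le> (x v)\<^sup>2 + 2 * t * (x v * y v) + t\<^sup>2 * (4 * c\<^sup>2)"
        by (simp add: power2_sum power_mult_distrib algebra_simps)
    qed
    also have "\<dots> = F \<alpha> + 2 * t * (\<Sum>v\<in>V. x v * y v) + t\<^sup>2 * (4 * c\<^sup>2 * N)"
      by (simp add: sum.distrib sum_distrib_left F_def x_def N_def)
    also have "\<dots> \<le> F \<alpha> + 2 * t * (\<delta> * (c * N) - F \<alpha>) + t\<^sup>2 * C"
      using t x\<beta> by (intro add_mono mult_left_mono) (auto simp: xy C_def)
    also have "\<dots> = F \<alpha> + t * (2 * \<delta> * (c * N) - 2 * F \<alpha> + t * C)"
      by (simp add: algebra_simps power2_eq_square)
    also have "\<dots> \<le> F \<alpha> + t * (m - 2 * m + m / 2)"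
      using t \<delta> tC m_le[OF \<alpha>] by (intro add_mono mult_left_mono) auto
    finally show ?thesis using \<open>\<gamma> \<in> D\<close> by (intro bexI[of _ \<gamma>]) (auto simp: algebra_simps)
  qed
  have "m < m + t * m / 2" using t \<open>m > 0\<close> by simp
  then obtain \<alpha> where "\<alpha> \<in> D" "F \<alpha> < m + t * m / 2"
    using cInf_lessD[of "F ` D" "m + t * m / 2"] \<open>D \<noteq> {}\<close> by (auto simp: m_def[symmetric])
  with step[OF this(1)] m_le show False by force
qed

section \<open>The cochain complex\<close>

definition face :: "nat \<Rightarrow> 'a list \<Rightarrow> 'a list" where
  "face j xs = take j xs @ drop (Suc j) xs"

definition to_front :: "nat \<Rightarrow> 'a list \<Rightarrow> 'a list" where
  "to_front j xs = xs ! j # face j xs"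

definition alternating :: "('a list \<Rightarrow> real) \<Rightarrow> bool" where
  "alternating \<phi> \<longleftrightarrow> (\<forall>us a vs b ws. \<phi> (us @ a # vs @ b # ws) = - \<phi> (us @ b # vs @ a # ws))"

text \<open>
  The coboundary operator is handled on arbitrary lists first, through its recursion along the list;
  the restriction to simplices is added afterwards.
\<close>
fun signed_face_sum :: "('a list \<Rightarrow> real) \<Rightarrow> 'a list \<Rightarrow> real" where
  "signed_face_sum \<psi> [] = 0"
| "signed_face_sum \<psi> (x # xs) = \<psi> xs - signed_face_sum (\<lambda>ys. \<psi> (x # ys)) xs"

lemma face_Suc_Cons [simp]: "face (Suc j) (x # xs) = x # face j xs"
  by (simp add: face_def)

lemma face_0_Cons [simp]: "face 0 (x # xs) = xs"
  by (simp add: face_def)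

lemma length_face: "j < length xs \<Longrightarrow> length (face j xs) = length xs - 1"
  by (simp add: face_def)

lemma set_face: "distinct xs \<Longrightarrow> j < length xs \<Longrightarrow> set (face j xs) = set xs - {xs ! j}"
proof (induction xs arbitrary: j)
  case (Cons x xs)
  then show ?case by (cases j) auto
qed simp

lemma distinct_face: "distinct xs \<Longrightarrow> distinct (face j xs)"
  by (simp add: face_def set_take_disj_set_drop_if_distinct)

lemma signed_face_sum_eq:
  "signed_face_sum \<psi> xs = (\<Sum>j<length xs. (- 1) ^ j * \<psi> (face j xs))"
  by (induction xs arbitrary: \<psi>) (simp_all add: sum.lessThan_Suc_shift sum_negf del: sum.lessThan_Suc)

lemma signed_face_sum_diff:
  "signed_face_sum (\<lambda>ys. \<psi> ys - \<chi> ys) xs = signed_face_sum \<psi> xs - signed_face_sum \<chi> xs"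
  by (simp add: signed_face_sum_eq right_diff_distrib sum_subtractf)

lemma signed_face_sum_minus:
  "signed_face_sum (\<lambda>ys. - \<psi> ys) xs = - signed_face_sum \<psi> xs"
  by (simp add: signed_face_sum_eq sum_negf)

text \<open>
  This is the identity \<open>\<delta>\<delta> = 0\<close>.  In the recursion the two copies of \<open>signed_face_sum \<psi> xs\<close>
  cancel, and the statement for the contracted cochain \<open>\<lambda>ys. \<psi> (x # ys)\<close> remains.
\<close>
lemma signed_face_sum_twice: "signed_face_sum (signed_face_sum \<psi>) xs = 0"
  by (induction xs arbitrary: \<psi>) (simp_all add: signed_face_sum_diff)

lemma alternatingD:
  "alternating \<phi> \<Longrightarrow> \<phi> (us @ a # vs @ b # ws) = - \<phi> (us @ b # vs @ a # ws)"
  unfolding alternating_def by blast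

lemma alternating_adjacentI:
  assumes "\<And>us a b ws. \<phi> (us @ a # b # ws) = - \<phi> (us @ b # a # ws)"
  shows "alternating \<phi>"
proof -
  have push: "\<phi> (us @ a # vs @ ws) = (- 1) ^ length vs * \<phi> (us @ vs @ a # ws)" for us a vs ws
  proof (induction vs arbitrary: us)
    case (Cons v vs)
    show ?case using assms[of us a v "vs @ ws"] Cons[of "us @ [v]"] by simp
  qed simp
  have "\<phi> (us @ a # vs @ b # ws) = - \<phi> (us @ b # vs @ a # ws)" for us a vs b ws
    using push[of us a vs "b # ws"] push[of us b vs "a # ws"] assms[of "us @ vs" a b ws] by simp
  then show ?thesis unfolding alternating_def by blast
qed

text \<open>
  Skew-symmetry turns the sign of the \<open>j\<close>-th face into the effect of moving the \<open>j\<close>-th vertex to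
  the front.  With this all faces of a simplex can be treated like the one opposite to its head.
\<close>
lemma alternating_to_front:
  assumes "alternating \<phi>" "j < length xs"
  shows "\<phi> (to_front j xs) = (- 1) ^ j * \<phi> xs"
proof -
  have push: "\<phi> (a # vs @ ws) = (- 1) ^ length vs * \<phi> (vs @ a # ws)" for a vs ws
  proof (induction vs arbitrary: ws rule: rev_induct)
    case (snoc v vs)
    have "\<phi> (vs @ a # v # ws) = - \<phi> (vs @ v # a # ws)"
      using alternatingD[OF assms(1), of vs a "[]" v ws] by simp
    then show ?case using snoc[of "v # ws"] by simp
  qed simp
  have "xs = take j xs @ xs ! j # drop (Suc j) xs"
    using assms(2) by (rule id_take_nth_drop)
  then show ?thesis
    using push[of "xs ! j" "take j xs" "drop (Suc j) xs"] assms(2)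
    by (simp add: to_front_def face_def min_def)
qed

lemma alternating_Cons:
  assumes "alternating \<phi>"
  shows "alternating (\<lambda>ys. \<phi> (x # ys))"
  unfolding alternating_def
proof (intro allI)
  fix us a vs b ws
  show "\<phi> (x # us @ a # vs @ b # ws) = - \<phi> (x # us @ b # vs @ a # ws)"
    using alternatingD[OF assms, of "x # us" a vs b ws] by simp
qed

lemma alternating_add:
  assumes "alternating \<phi>" "alternating \<psi>"
  shows "alternating (\<lambda>xs. \<phi> xs + \<psi> xs)"
  unfolding alternating_def
proof (intro allI)
  fix us a vs b ws
  show "\<phi> (us @ a # vs @ b # ws) + \<psi> (us @ a # vs @ b # ws)
      = - (\<phi> (us @ b # vs @ a # ws) + \<psi> (us @ b # vs @ a # ws))"
    using alternatingD[OF assms(1), of us a vs b ws] alternatingD[OF assms(2), of us a vs b ws] by simp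
qed

lemma alternating_scale:
  assumes "alternating \<phi>"
  shows "alternating (\<lambda>xs. r * \<phi> xs)"
  unfolding alternating_def
proof (intro allI)
  fix us a vs b ws
  show "r * \<phi> (us @ a # vs @ b # ws) = - (r * \<phi> (us @ b # vs @ a # ws))"
    using alternatingD[OF assms, of us a vs b ws] by simp
qed

lemma alternating_signed_face_sum:
  assumes "alternating \<psi>"
  shows "alternating (signed_face_sum \<psi>)"
proof (rule alternating_adjacentI)
  fix us a b ws
  show "signed_face_sum \<psi> (us @ a # b # ws) = - signed_face_sum \<psi> (us @ b # a # ws)"
    using assms
  proof (induction us arbitrary: \<psi>)
    case Nil
    have "\<psi> (a # b # ys) = - \<psi> (b # a # ys)" for ys
      using alternatingD[OF Nil, of "[]" a "[]" b ys] by simp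
    then show ?case by (simp add: signed_face_sum_minus)
  next
    case (Cons x us)
    have "\<psi> (us @ a # b # ws) = - \<psi> (us @ b # a # ws)"
      using alternatingD[OF Cons.prems, of us a "[]" b ws] by simp
    then show ?case using Cons.IH[OF alternating_Cons[OF Cons.prems], of x] by simp
  qed
qed

lemma coboundary_eq:
  "coboundary K \<psi> xs = (if ordered_simplex K xs then signed_face_sum \<psi> xs else 0)"
  by (simp add: coboundary_def signed_face_sum_eq face_def)

lemma cochains_iff:
  "\<phi> \<in> cochains K i \<longleftrightarrow>
     (\<forall>xs. \<phi> xs \<noteq> 0 \<longrightarrow> ordered_simplex K xs \<and> int (length xs) = i + 1) \<and> alternating \<phi>"
  by (simp add: cochains_def alternating_def)

lemma cochains_zero: "(\<lambda>_. 0) \<in> cochains K i"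
  by (simp add: cochains_iff alternating_def)

lemma cochains_add: "\<phi> \<in> cochains K i \<Longrightarrow> \<psi> \<in> cochains K i \<Longrightarrow> (\<lambda>xs. \<phi> xs + \<psi> xs) \<in> cochains K i"
  unfolding cochains_iff by (simp add: alternating_add) (metis add.right_neutral)

lemma cochains_scale: "\<phi> \<in> cochains K i \<Longrightarrow> (\<lambda>xs. r * \<phi> xs) \<in> cochains K i"
  unfolding cochains_iff by (auto intro!: alternating_scale)

lemma coboundary_add: "coboundary K (\<lambda>xs. \<phi> xs + \<psi> xs) = (\<lambda>xs. coboundary K \<phi> xs + coboundary K \<psi> xs)"
  by (auto simp: coboundary_def distrib_left sum.distrib)

lemma coboundary_scale: "coboundary K (\<lambda>xs. r * \<phi> xs) = (\<lambda>xs. r * coboundary K \<phi> xs)"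
  by (auto simp: coboundary_def sum_distrib_left mult.left_commute)

lemma cocycles_zero: "(\<lambda>_. 0) \<in> cocycles K i"
  by (auto simp: cocycles_def cochains_zero coboundary_def)

lemma cocycles_add: "\<phi> \<in> cocycles K i \<Longrightarrow> \<psi> \<in> cocycles K i \<Longrightarrow> (\<lambda>xs. \<phi> xs + \<psi> xs) \<in> cocycles K i"
  by (simp add: cocycles_def cochains_add coboundary_add)

lemma cocycles_scale: "\<phi> \<in> cocycles K i \<Longrightarrow> (\<lambda>xs. r * \<phi> xs) \<in> cocycles K i"
  by (simp add: cocycles_def cochains_scale coboundary_scale)

lemma coboundaries_zero: "(\<lambda>_. 0) \<in> coboundaries K i"
  unfolding coboundaries_def
  by (rule image_eqI[OF _ cochains_zero]) (auto simp: coboundary_def)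

lemma coboundaries_add:
  assumes "\<phi> \<in> coboundaries K i" "\<psi> \<in> coboundaries K i"
  shows "(\<lambda>xs. \<phi> xs + \<psi> xs) \<in> coboundaries K i"
proof -
  obtain \<phi>' \<psi>' where eq: "\<phi> = coboundary K \<phi>'" "\<psi> = coboundary K \<psi>'"
    and "\<phi>' \<in> cochains K (i - 1)" "\<psi>' \<in> cochains K (i - 1)"
    using assms by (auto simp: coboundaries_def)
  then have "coboundary K (\<lambda>xs. \<phi>' xs + \<psi>' xs) \<in> coboundaries K i"
    unfolding coboundaries_def by (intro imageI cochains_add)
  then show ?thesis by (simp only: coboundary_add eq)
qed

lemma coboundaries_scale:
  assumes "\<phi> \<in> coboundaries K i"
  shows "(\<lambda>xs. r * \<phi> xs) \<in> coboundaries K i"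
proof -
  obtain \<phi>' where eq: "\<phi> = coboundary K \<phi>'" and "\<phi>' \<in> cochains K (i - 1)"
    using assms by (auto simp: coboundaries_def)
  then have "coboundary K (\<lambda>xs. r * \<phi>' xs) \<in> coboundaries K i"
    unfolding coboundaries_def by (intro imageI cochains_scale)
  then show ?thesis by (simp only: coboundary_scale eq)
qed

text \<open>
  The quotient has a single coset, the set of cocycles itself, and its group axioms hold by
  inspection.
\<close>
lemma trivial_cohomologyI:
  assumes sub: "cocycles K i \<subseteq> coboundaries K i"
    and sup: "coboundaries K i \<subseteq> cocycles K i"
  shows "trivial_group (reduced_cohomology K i)"
proof -
  let ?Z = "cocycles K i"
  have Z: "coboundaries K i = ?Z" using sub sup by blast
  have neg: "(\<lambda>xs. - \<phi> xs) \<in> ?Z" if "\<phi> \<in> ?Z" for \<phi>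
    using cocycles_scale[OF that, of "-1"] by simp
  have coset: "?Z #>\<^bsub>cocycle_group K i\<^esub> \<phi> = ?Z" if "\<phi> \<in> ?Z" for \<phi>
  proof -
    have "\<psi> \<in> (\<lambda>\<chi> xs. \<chi> xs + \<phi> xs) ` ?Z" if "\<psi> \<in> ?Z" for \<psi>
      using cocycles_add[OF that neg[OF \<open>\<phi> \<in> ?Z\<close>]]
      by (intro image_eqI[of _ _ "\<lambda>xs. \<psi> xs + - \<phi> xs"]) auto
    then show ?thesis
      using cocycles_add[OF _ that] by (auto simp: r_coset_def cocycle_group_def)
  qed
  have "carrier (cocycle_group K i) = ?Z" by (simp add: cocycle_group_def)
  then have carrier: "carrier (reduced_cohomology K i) = {?Z}"
    using coset cocycles_zero[of K i]
    by (auto simp: reduced_cohomology_def FactGroup_def RCOSETS_def Z)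
  have one: "\<one>\<^bsub>reduced_cohomology K i\<^esub> = ?Z"
    by (simp add: reduced_cohomology_def FactGroup_def Z)
  have "?Z <#>\<^bsub>cocycle_group K i\<^esub> ?Z = (\<Union>\<phi>\<in>?Z. ?Z #>\<^bsub>cocycle_group K i\<^esub> \<phi>)"
    by (auto simp: set_mult_def r_coset_def)
  also have "\<dots> = ?Z" using coset cocycles_zero by auto
  finally have mult: "?Z \<otimes>\<^bsub>reduced_cohomology K i\<^esub> ?Z = ?Z"
    by (simp add: reduced_cohomology_def FactGroup_def)
  have "group (reduced_cohomology K i)"
    by (rule groupI) (auto simp: carrier one mult)
  then show ?thesis by (simp add: trivial_group_def carrier one)
qed

section \<open>Weighted complexes and harmonic cochains\<close>

text \<open>
  A positive weighting of the vertices gives each simplex the product of the weights of its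
  vertices, and thereby an inner product on cochains.  Sums run over ordered simplices, so each
  simplex is counted once for every ordering of its vertices, a factor common to all terms of
  one dimension.
\<close>
locale weighted_complex =
  fixes K :: "'a set set" and V :: "'a set" and w :: "'a \<Rightarrow> real"
  assumes finite_vertices: "finite V"
    and simplex_subset: "\<And>S. S \<in> K \<Longrightarrow> S \<subseteq> V"
    and simplex_down: "\<And>S T. S \<in> K \<Longrightarrow> T \<subseteq> S \<Longrightarrow> T \<in> K"
    and weight_pos: "\<And>v. v \<in> V \<Longrightarrow> w v > 0"
begin

definition simplices :: "nat \<Rightarrow> 'a list set" where
  "simplices n = {xs. ordered_simplex K xs \<and> length xs = n}"

definition weight :: "'a list \<Rightarrow> real" where
  "weight xs = (\<Prod>x\<leftarrow>xs. w x)"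

text \<open>
  Up to the factor in \<open>codiff_adjoint\<close> this is the adjoint of the coboundary for the weighted
  inner products.
\<close>
definition codiff :: "('a list \<Rightarrow> real) \<Rightarrow> 'a list \<Rightarrow> real" where
  "codiff \<phi> xs = (\<Sum>v\<in>V. w v * \<phi> (v # xs))"

lemma weight_Cons [simp]: "weight (x # xs) = w x * weight xs"
  by (simp add: weight_def)

lemma simplicesD:
  assumes "xs \<in> simplices n"
  shows "distinct xs" "set xs \<in> K" "set xs \<subseteq> V" "length xs = n"
  using assms simplex_subset by (auto simp: simplices_def ordered_simplex_def)

lemma finite_simplices: "finite (simplices n)"
  by (rule finite_subset[OF _ finite_lists_length_eq[OF finite_vertices, of n]])
     (auto dest: simplicesD)

lemma weight_simplex_pos: "xs \<in> simplices n \<Longrightarrow> weight xs > 0"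
proof -
  have "set ys \<subseteq> V \<Longrightarrow> weight ys > 0" for ys
    by (induction ys) (auto simp: weight_def weight_pos)
  then show "xs \<in> simplices n \<Longrightarrow> weight xs > 0" using simplicesD(3) by blast
qed

lemma Cons_simplicesD: "v # xs \<in> simplices (Suc n) \<Longrightarrow> v \<in> V \<and> xs \<in> simplices n"
  using simplex_down[of "insert v (set xs)" "set xs"] simplicesD(3)[of "v # xs"]
  by (auto simp: simplices_def ordered_simplex_def)

lemma face_simplex:
  assumes "xs \<in> simplices (Suc n)" "j < Suc n"
  shows "face j xs \<in> simplices n"
  using assms simplex_down[of "set xs" "set (face j xs)"]
  by (auto simp: simplices_def ordered_simplex_def distinct_face set_face length_face)

lemma cochain_support:
  "\<phi> \<in> cochains K (int n) \<Longrightarrow> xs \<notin> simplices (Suc n) \<Longrightarrow> \<phi> xs = 0"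
  by (auto simp: cochains_iff simplices_def)

lemma cochainsI:
  assumes "\<And>xs. \<phi> xs \<noteq> 0 \<Longrightarrow> xs \<in> simplices n" "alternating \<phi>"
  shows "\<phi> \<in> cochains K (int n - 1)"
  using assms by (auto simp: cochains_iff simplices_def)

text \<open>
  A face of a simplex is a simplex, so on simplices the restricted coboundary iterates like the
  unrestricted one; reordering the vertices preserves simplices, so skew-symmetry survives.
\<close>
lemma coboundaries_subset_cocycles: "coboundaries K (int n) \<subseteq> cocycles K (int n)"
proof
  fix \<chi> assume "\<chi> \<in> coboundaries K (int n)"
  then obtain \<psi> where \<psi>: "\<psi> \<in> cochains K (int n - 1)" and \<chi>: "\<chi> = coboundary K \<psi>"
    by (auto simp: coboundaries_def)
  have "xs \<in> simplices (Suc n)" if "\<chi> xs \<noteq> 0" for xs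
  proof -
    have xs: "ordered_simplex K xs" "signed_face_sum \<psi> xs \<noteq> 0"
      using that by (auto simp: \<chi> coboundary_eq split: if_splits)
    then obtain j where j: "j < length xs" "\<psi> (face j xs) \<noteq> 0"
      unfolding signed_face_sum_eq by (metis (no_types, lifting) lessThan_iff mult_zero_right sum.neutral)
    then have "length (face j xs) = n" using \<psi> by (auto simp: cochains_iff)
    then show ?thesis using xs j by (auto simp: simplices_def length_face)
  qed
  moreover have "alternating \<chi>"
    unfolding alternating_def
  proof (intro allI)
    fix us a vs b ws
    have "ordered_simplex K (us @ a # vs @ b # ws) = ordered_simplex K (us @ b # vs @ a # ws)"
      by (auto simp: ordered_simplex_def insert_commute)
    then show "\<chi> (us @ a # vs @ b # ws) = - \<chi> (us @ b # vs @ a # ws)"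
      using alternatingD[OF alternating_signed_face_sum, of \<psi> us a vs b ws] \<psi>
      by (simp add: \<chi> coboundary_eq cochains_iff)
  qed
  ultimately have "\<chi> \<in> cochains K (int n)"
    using cochainsI[of \<chi> "Suc n"] by simp
  moreover have "coboundary K \<chi> xs = 0" for xs
  proof (cases "ordered_simplex K xs")
    case True
    have "\<chi> (face j xs) = signed_face_sum \<psi> (face j xs)" if "j < length xs" for j
      using face_simplex[of xs "length xs - 1" j] True that
      by (auto simp: \<chi> coboundary_eq simplices_def)
    then have "signed_face_sum \<chi> xs = signed_face_sum (signed_face_sum \<psi>) xs"
      unfolding signed_face_sum_eq[of _ xs] by simp
    then show ?thesis by (simp add: coboundary_eq signed_face_sum_twice)
  qed (simp add: coboundary_eq)
  ultimately show "\<chi> \<in> cocycles K (int n)" by (auto simp: cocycles_def)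
qed

lemma weight_to_front:
  assumes "j < length xs"
  shows "weight (to_front j xs) = weight xs"
proof -
  have "weight xs = weight (take j xs @ xs ! j # drop (Suc j) xs)"
    using id_take_nth_drop[OF assms] by simp
  then show ?thesis by (simp add: weight_def to_front_def face_def)
qed

text \<open>
  Moving the \<open>j\<close>-th vertex to the front permutes the ordered simplices.  This is how sums over
  all faces collapse to multiples of a sum over the first one.
\<close>
lemma sum_to_front:
  assumes "j < n"
  shows "(\<Sum>xs\<in>simplices n. F (to_front j xs)) = (\<Sum>xs\<in>simplices n. F xs)"
proof (rule sum.reindex_bij_betw)
  define insert_back where "insert_back = (\<lambda>xs::'a list. take j (tl xs) @ hd xs # drop j (tl xs))"
  have set_to_front: "set (to_front j xs) = set xs" "distinct (to_front j xs) = distinct xs"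
    if "length xs = n" for xs
  proof -
    have xs: "xs = take j xs @ xs ! j # drop (Suc j) xs"
      using id_take_nth_drop[of j xs] that assms by simp
    have "set (take j xs @ xs ! j # drop (Suc j) xs) = set (to_front j xs)"
         "distinct (take j xs @ xs ! j # drop (Suc j) xs) = distinct (to_front j xs)"
      by (auto simp: to_front_def face_def)
    with xs show "set (to_front j xs) = set xs" "distinct (to_front j xs) = distinct xs" by metis+
  qed
  have mem: "to_front j xs \<in> simplices n \<longleftrightarrow> xs \<in> simplices n" if "length xs = n" for xs
    using set_to_front[OF that] that assms
    by (simp add: simplices_def ordered_simplex_def) (auto simp: to_front_def length_face)
  have inv: "to_front j (insert_back ys) = ys" "length (insert_back ys) = n" "insert_back (to_front j ys) = ys"
    if "length ys = n" for ys
  proof -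
    obtain y zs where ys: "ys = y # zs" using \<open>length ys = n\<close> assms by (cases ys) auto
    then have "j \<le> length zs" using that assms by simp
    then show "to_front j (insert_back ys) = ys" "length (insert_back ys) = n"
      using that by (auto simp: ys insert_back_def to_front_def face_def nth_append)
    show "insert_back (to_front j ys) = ys"
      using id_take_nth_drop[of j ys] that assms
      by (simp add: insert_back_def to_front_def face_def)
  qed
  show "bij_betw (to_front j) (simplices n) (simplices n)"
  proof (rule bij_betw_byWitness[of _ insert_back])
    show "\<forall>xs\<in>simplices n. insert_back (to_front j xs) = xs" using inv simplicesD(4) by blast
    show "\<forall>xs\<in>simplices n. to_front j (insert_back xs) = xs" using inv simplicesD(4) by blast
    show "to_front j ` simplices n \<subseteq> simplices n" using mem simplicesD(4) by blast
    show "insert_back ` simplices n \<subseteq> simplices n" using mem inv simplicesD(4) by (metis image_subsetI)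
  qed
qed

lemma sum_simplices_Suc:
  "(\<Sum>xs\<in>simplices (Suc n). F xs) =
     (\<Sum>xs\<in>simplices n. \<Sum>v\<in>V. if v # xs \<in> simplices (Suc n) then F (v # xs) else 0)"
proof -
  have "(\<Sum>xs\<in>simplices n. \<Sum>v\<in>V. if v # xs \<in> simplices (Suc n) then F (v # xs) else 0)
      = (\<Sum>(xs, v)\<in>simplices n \<times> V. if v # xs \<in> simplices (Suc n) then F (v # xs) else 0)"
    by (simp add: sum.cartesian_product)
  also have "\<dots> = (\<Sum>(xs, v)\<in>{(xs, v)\<in>simplices n \<times> V. v # xs \<in> simplices (Suc n)}. F (v # xs))"
    using finite_simplices finite_vertices by (intro sum.mono_neutral_cong_right) (auto split: if_splits)
  also have "\<dots> = (\<Sum>xs\<in>simplices (Suc n). F xs)"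
  proof (rule sum.reindex_bij_witness[of _ "\<lambda>xs. (tl xs, hd xs)" "\<lambda>(xs, v). v # xs"])
    show "(tl xs, hd xs) \<in> {(xs, v)\<in>simplices n \<times> V. v # xs \<in> simplices (Suc n)}"
      if "xs \<in> simplices (Suc n)" for xs
      using that Cons_simplicesD[of "hd xs" "tl xs" n] simplicesD(4)[OF that] by (cases xs) auto
    show "(case (tl xs, hd xs) of (xs, v) \<Rightarrow> v # xs) = xs" if "xs \<in> simplices (Suc n)" for xs
      using simplicesD(4)[OF that] by (cases xs) auto
  qed auto
  finally show ?thesis by simp
qed

lemma codiff_adjoint:
  assumes \<phi>: "\<phi> \<in> cochains K (int n)"
  shows "(\<Sum>xs\<in>simplices (Suc n). weight xs * \<phi> xs * coboundary K \<psi> xs) =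
         real (Suc n) * (\<Sum>xs\<in>simplices n. weight xs * codiff \<phi> xs * \<psi> xs)"
proof -
  define F where "F = (\<lambda>xs. weight xs * \<phi> xs * \<psi> (tl xs))"
  have "(\<Sum>xs\<in>simplices (Suc n). weight xs * \<phi> xs * coboundary K \<psi> xs) =
        (\<Sum>xs\<in>simplices (Suc n). \<Sum>j<Suc n. F (to_front j xs))"
  proof (rule sum.cong[OF refl])
    fix xs assume xs: "xs \<in> simplices (Suc n)"
    have "F (to_front j xs) = weight xs * \<phi> xs * ((- 1) ^ j * \<psi> (face j xs))" if "j < Suc n" for j
      using alternating_to_front[of \<phi> j xs] weight_to_front[of j xs] simplicesD(4)[OF xs] \<phi> that
      by (simp add: F_def cochains_iff) (simp add: to_front_def)
    then show "weight xs * \<phi> xs * coboundary K \<psi> xs = (\<Sum>j<Suc n. F (to_front j xs))"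
      using xs by (simp add: coboundary_eq signed_face_sum_eq simplices_def sum_distrib_left del: sum.lessThan_Suc)
  qed
  also have "\<dots> = (\<Sum>j<Suc n. \<Sum>xs\<in>simplices (Suc n). F (to_front j xs))"
    by (rule sum.swap)
  also have "\<dots> = real (Suc n) * (\<Sum>xs\<in>simplices (Suc n). F xs)"
    using sum_to_front[of _ "Suc n" F] by simp
  also have "(\<Sum>xs\<in>simplices (Suc n). F xs) = (\<Sum>xs\<in>simplices n. weight xs * codiff \<phi> xs * \<psi> xs)"
    unfolding sum_simplices_Suc F_def codiff_def
    using cochain_support[OF \<phi>]
    by (auto simp: sum_distrib_left sum_distrib_right mult_ac intro!: sum.cong)
  finally show ?thesis .
qed

lemma codiff_cochain:
  assumes \<phi>: "\<phi> \<in> cochains K (int n)"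
  shows "codiff \<phi> \<in> cochains K (int n - 1)"
proof (rule cochainsI)
  fix xs assume "codiff \<phi> xs \<noteq> 0"
  then obtain v where "v \<in> V" "\<phi> (v # xs) \<noteq> 0"
    unfolding codiff_def by (metis (no_types, lifting) mult_zero_right sum.neutral)
  then show "xs \<in> simplices n"
    using cochain_support[OF \<phi>, of "v # xs"] Cons_simplicesD by blast
next
  have alt: "alternating \<phi>" using \<phi> by (simp add: cochains_iff)
  show "alternating (codiff \<phi>)"
    unfolding alternating_def
  proof (intro allI)
    fix us a vs b ws
    show "codiff \<phi> (us @ a # vs @ b # ws) = - codiff \<phi> (us @ b # vs @ a # ws)"
      using alternatingD[OF alternating_Cons[OF alt], of _ us a vs b ws]
      unfolding codiff_def sum_negf[symmetric] by (intro sum.cong) auto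
  qed
qed

text \<open>
  The finite-dimensional Hodge theorem, in the direction that matters here: projecting a cocycle
  that is not a coboundary onto the orthogonal complement of the coboundaries leaves a nonzero
  cocycle, and orthogonality to \<open>coboundary K (codiff \<phi>)\<close> says by adjointness that
  \<open>codiff \<phi>\<close> has norm zero.
\<close>
lemma harmonic_representative:
  assumes "\<not> cocycles K (int n) \<subseteq> coboundaries K (int n)"
  shows "\<exists>\<phi>\<in>cocycles K (int n). \<phi> \<noteq> (\<lambda>_. 0) \<and> (\<forall>xs. codiff \<phi> xs = 0)"
proof -
  obtain f where f: "f \<in> cocycles K (int n)" "f \<notin> coboundaries K (int n)"
    using assms by blast
  have "\<exists>p\<in>coboundaries K (int n). \<forall>b\<in>coboundaries K (int n).
      (\<Sum>xs\<in>simplices (Suc n). weight xs * (f xs - p xs) * b xs) = 0"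
  proof (rule orthogonal_projection_exists)
    show "b xs = 0" if "b \<in> coboundaries K (int n)" "xs \<notin> simplices (Suc n)" for b xs
      using that coboundaries_subset_cocycles[of n] cochain_support by (auto simp: cocycles_def)
  qed (auto simp: finite_simplices coboundaries_zero
        intro: weight_simplex_pos coboundaries_add coboundaries_scale)
  then obtain p where p: "p \<in> coboundaries K (int n)"
    and orth: "\<And>b. b \<in> coboundaries K (int n) \<Longrightarrow>
        (\<Sum>xs\<in>simplices (Suc n). weight xs * (f xs - p xs) * b xs) = 0" by blast
  define \<phi> where "\<phi> = (\<lambda>xs. f xs + - 1 * p xs)"
  have \<phi>: "\<phi> \<in> cocycles K (int n)"
    unfolding \<phi>_def using f(1) p coboundaries_subset_cocycles
    by (intro cocycles_add cocycles_scale) auto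
  then have \<phi>_cochain: "\<phi> \<in> cochains K (int n)" by (simp add: cocycles_def)
  have "\<phi> \<noteq> (\<lambda>_. 0)"
  proof
    assume "\<phi> = (\<lambda>_. 0)"
    then have "f = p" by (auto simp: \<phi>_def fun_eq_iff)
    with f p show False by simp
  qed
  moreover have "codiff \<phi> xs = 0" for xs
  proof -
    have "coboundary K (codiff \<phi>) \<in> coboundaries K (int n)"
      unfolding coboundaries_def using codiff_cochain[OF \<phi>_cochain] by blast
    then have "(\<Sum>ys\<in>simplices n. weight ys * codiff \<phi> ys * codiff \<phi> ys) = 0"
      using orth codiff_adjoint[OF \<phi>_cochain, of "codiff \<phi>"] by (simp add: \<phi>_def)
    then have "weight ys * codiff \<phi> ys * codiff \<phi> ys = 0" if "ys \<in> simplices n" for ys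
      using that weight_simplex_pos[of _ n] finite_simplices
      by (subst (asm) sum_nonneg_eq_0_iff) (auto simp: mult.assoc less_imp_le)
    then have "codiff \<phi> ys = 0" if "ys \<in> simplices n" for ys
      using that weight_simplex_pos[OF that] by fastforce
    moreover have "codiff \<phi> ys = 0" if "ys \<notin> simplices n" for ys
      using that codiff_cochain[OF \<phi>_cochain] by (auto simp: cochains_iff simplices_def)
    ultimately show ?thesis by blast
  qed
  ultimately show ?thesis using \<phi> by blast
qed

text \<open>
  The expansion of \<open>0 = \<langle>\<delta>\<phi>, \<delta>\<phi>\<rangle>\<close> into links, as in the methods of Bochner and Garland.  On a
  simplex \<open>u # ys\<close> the cocycle condition expresses \<open>\<phi> ys\<close> by the faces containing \<open>u\<close>; after
  multiplication with \<open>\<phi> ys\<close> each of them becomes a product \<open>\<phi> (u # xs) * \<phi> (v # xs)\<close> with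
  \<open>u\<close> and \<open>v\<close> spanning an edge of the link of \<open>xs\<close>.
\<close>
lemma harmonic_identity:
  assumes \<phi>: "\<phi> \<in> cocycles K (int n)"
  shows "(\<Sum>xs\<in>simplices (Suc n). weight xs * (\<phi> xs)\<^sup>2 *
            (\<Sum>v\<in>V. if v # xs \<in> simplices (Suc (Suc n)) then w v else 0)) =
         real (Suc n) * (\<Sum>xs\<in>simplices n. weight xs *
            (\<Sum>u\<in>V. \<Sum>v\<in>V. if v # u # xs \<in> simplices (Suc (Suc n))
               then w u * w v * \<phi> (u # xs) * \<phi> (v # xs) else 0))"
proof -
  let ?S = "simplices (Suc (Suc n))"
  have alt: "alternating \<phi>" using \<phi> by (simp add: cocycles_def cochains_iff)
  define F where "F = (\<lambda>xs. weight xs * \<phi> (hd (tl xs) # tl (tl xs)) * \<phi> (hd xs # tl (tl xs)))"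
  have "(\<Sum>xs\<in>simplices (Suc n). weight xs * (\<phi> xs)\<^sup>2 *
            (\<Sum>v\<in>V. if v # xs \<in> ?S then w v else 0)) = (\<Sum>xs\<in>?S. weight xs * (\<phi> (tl xs))\<^sup>2)"
    unfolding sum_simplices_Suc[of _ "Suc n"]
    by (auto simp: sum_distrib_left mult_ac intro!: sum.cong)
  also have "\<dots> = (\<Sum>xs\<in>?S. \<Sum>j<Suc n. F (to_front (Suc j) xs))"
  proof (rule sum.cong[OF refl])
    fix xs assume xs: "xs \<in> ?S"
    then obtain u ys where ys: "xs = u # ys" "length ys = Suc n"
      using simplicesD(4)[OF xs] by (cases xs) auto
    have "coboundary K \<phi> xs = 0" using \<phi> by (simp add: cocycles_def)
    then have "\<phi> ys = signed_face_sum (\<lambda>zs. \<phi> (u # zs)) ys"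
      using xs ys by (simp add: coboundary_eq simplices_def)
    then have "\<phi> ys = (\<Sum>j<Suc n. (- 1) ^ j * \<phi> (u # face j ys))"
      by (simp only: signed_face_sum_eq ys(2))
    then have "\<phi> ys * \<phi> ys = (\<Sum>j<Suc n. \<phi> ys * ((- 1) ^ j * \<phi> (u # face j ys)))"
      by (metis sum_distrib_left)
    also have "\<dots> = (\<Sum>j<Suc n. \<phi> (to_front j ys) * \<phi> (u # face j ys))"
      using alternating_to_front[OF alt, of _ ys] ys(2) by (intro sum.cong) auto
    finally have sq: "\<phi> ys * \<phi> ys = (\<Sum>j<Suc n. \<phi> (to_front j ys) * \<phi> (u # face j ys))" .
    have "F (to_front (Suc j) xs) = weight xs * (\<phi> (to_front j ys) * \<phi> (u # face j ys))"
      if "j < Suc n" for j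
      using weight_to_front[of "Suc j" xs] ys that by (simp add: F_def) (simp add: to_front_def)
    then show "weight xs * (\<phi> (tl xs))\<^sup>2 = (\<Sum>j<Suc n. F (to_front (Suc j) xs))"
      by (simp add: power2_eq_square ys(1) sq sum_distrib_left del: sum.lessThan_Suc)
  qed
  also have "\<dots> = (\<Sum>j<Suc n. \<Sum>xs\<in>?S. F (to_front (Suc j) xs))"
    by (rule sum.swap)
  also have "\<dots> = real (Suc n) * (\<Sum>xs\<in>?S. F xs)"
    using sum_to_front[of "Suc j" "Suc (Suc n)" F for j] by simp
  also have "(\<Sum>xs\<in>?S. F xs) = (\<Sum>xs\<in>simplices n. weight xs *
            (\<Sum>u\<in>V. \<Sum>v\<in>V. if v # u # xs \<in> ?S
               then w u * w v * \<phi> (u # xs) * \<phi> (v # xs) else 0))"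
  proof -
    have "v # u # xs \<notin> ?S" if "u # xs \<notin> simplices (Suc n)" for u v xs
      using that Cons_simplicesD by blast
    then show ?thesis
      unfolding sum_simplices_Suc F_def
      by (auto simp: sum_distrib_left mult_ac intro!: sum.cong sum.neutral)
  qed
  finally show ?thesis .
qed

text \<open>
  A pair of a face and a vertex of its link is a simplex with a distinguished vertex, and by
  symmetry that vertex may be placed in any of the \<open>n + 1\<close> positions.
\<close>
lemma sum_pointed_simplices:
  assumes "alternating \<phi>"
  shows "real (Suc n) * (\<Sum>xs\<in>simplices n. weight xs *
            (\<Sum>u\<in>V. if u # xs \<in> simplices (Suc n) then w u * (\<phi> (u # xs))\<^sup>2 * h u (set xs) else 0)) =
         (\<Sum>xs\<in>simplices (Suc n). weight xs * (\<phi> xs)\<^sup>2 * (\<Sum>u\<in>set xs. h u (set xs - {u})))"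
proof -
  define F where "F = (\<lambda>xs. weight xs * (\<phi> xs)\<^sup>2 * h (hd xs) (set (tl xs)))"
  have "(\<Sum>xs\<in>simplices n. weight xs *
            (\<Sum>u\<in>V. if u # xs \<in> simplices (Suc n) then w u * (\<phi> (u # xs))\<^sup>2 * h u (set xs) else 0)) =
        (\<Sum>xs\<in>simplices (Suc n). F xs)"
    unfolding sum_simplices_Suc[of _ n] F_def
    by (auto simp: sum_distrib_left mult_ac intro!: sum.cong)
  then have "real (Suc n) * (\<Sum>xs\<in>simplices n. weight xs *
            (\<Sum>u\<in>V. if u # xs \<in> simplices (Suc n) then w u * (\<phi> (u # xs))\<^sup>2 * h u (set xs) else 0)) =
        (\<Sum>j<Suc n. \<Sum>xs\<in>simplices (Suc n). F (to_front j xs))"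
    using sum_to_front[of _ "Suc n" F] by simp
  also have "\<dots> = (\<Sum>xs\<in>simplices (Suc n). \<Sum>j<Suc n. F (to_front j xs))"
    by (rule sum.swap)
  also have "\<dots> = (\<Sum>xs\<in>simplices (Suc n). weight xs * (\<phi> xs)\<^sup>2 * (\<Sum>u\<in>set xs. h u (set xs - {u})))"
  proof (rule sum.cong[OF refl])
    fix xs assume xs: "xs \<in> simplices (Suc n)"
    have sq: "(\<phi> (to_front j xs))\<^sup>2 = (\<phi> xs)\<^sup>2" if "j < Suc n" for j
      using alternating_to_front[OF assms, of j xs] simplicesD(4)[OF xs] that
      by (simp add: power_mult_distrib power_even_eq[symmetric] flip: power_mult)
    have "F (to_front j xs) = weight xs * (\<phi> xs)\<^sup>2 * h (xs ! j) (set xs - {xs ! j})" if "j < Suc n" for j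
      using weight_to_front[of j xs] set_face[of xs j] simplicesD[OF xs] sq[OF that] that
      by (simp add: F_def) (simp add: to_front_def)
    then have "(\<Sum>j<Suc n. F (to_front j xs)) =
        weight xs * (\<phi> xs)\<^sup>2 * (\<Sum>j<Suc n. h (xs ! j) (set xs - {xs ! j}))"
      by (simp add: sum_distrib_left del: sum.lessThan_Suc)
    also have "(\<Sum>j<Suc n. h (xs ! j) (set xs - {xs ! j})) = (\<Sum>u\<in>set xs. h u (set xs - {u}))"
      using bij_betw_nth[of xs "{..<Suc n}" "set xs"] simplicesD[OF xs]
      by (intro sum.reindex_bij_betw) simp
    finally show "(\<Sum>j<Suc n. F (to_front j xs)) = weight xs * (\<phi> xs)\<^sup>2 * (\<Sum>u\<in>set xs. h u (set xs - {u}))" .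
  qed
  finally show ?thesis .
qed

end

section \<open>Weighted representations\<close>

text \<open>
  The only features of a vector representation that enter are those of its Gram matrix \<open>M\<close>: it is
  symmetric, positive semidefinite, and entrywise at least the adjacency matrix.
\<close>
locale weighted_representation = pair_graph G for G :: "'a pair_pre_digraph" +
  fixes M :: "'a \<Rightarrow> 'a \<Rightarrow> real" and w :: "'a \<Rightarrow> real"
  assumes adj_le: "\<And>u v. u \<in> pverts G \<Longrightarrow> v \<in> pverts G \<Longrightarrow> of_bool ((u, v) \<in> parcs G) \<le> M u v"
    and M_sym: "\<And>u v. u \<in> pverts G \<Longrightarrow> v \<in> pverts G \<Longrightarrow> M u v = M v u"
    and M_psd: "\<And>x. (\<Sum>u\<in>pverts G. \<Sum>v\<in>pverts G. M u v * x u * x v) \<ge> 0"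
    and w_pos: "\<And>v. v \<in> pverts G \<Longrightarrow> w v > 0"
begin

lemma adj_sym: "(u, v) \<in> parcs G \<longleftrightarrow> (v, u) \<in> parcs G"
  using arcs_symmetric by blast

lemma no_loop: "(u, u) \<notin> parcs G"
  using no_loops' by blast

abbreviation K where "K \<equiv> independence_complex G"

sublocale weighted_complex K "pverts G" w
  by unfold_locales (auto simp: independence_complex_def independent_set_def w_pos)

lemma insert_simplex_iff:
  "u \<in> pverts G \<Longrightarrow> insert u S \<in> K \<longleftrightarrow> S \<in> K \<and> (\<forall>v\<in>S. (u, v) \<notin> parcs G)"
  using adj_sym no_loop by (auto simp: independence_complex_def independent_set_def)

lemma Cons_simplex_iff:
  assumes "u \<in> pverts G"
  shows "u # xs \<in> simplices (Suc n) \<longleftrightarrow>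
     xs \<in> simplices n \<and> u \<notin> set xs \<and> (\<forall>v\<in>set xs. (u, v) \<notin> parcs G)"
  using insert_simplex_iff[OF assms] by (auto simp: simplices_def ordered_simplex_def)

definition excess :: "'a \<Rightarrow> 'a \<Rightarrow> real" where
  "excess u v = M u v - of_bool ((u, v) \<in> parcs G)"

lemma excess_nonneg: "u \<in> pverts G \<Longrightarrow> v \<in> pverts G \<Longrightarrow> excess u v \<ge> 0"
  using adj_le by (simp add: excess_def)

definition in_link :: "'a set \<Rightarrow> 'a \<Rightarrow> real" where
  "in_link S v = of_bool (v \<notin> S \<and> (\<forall>x\<in>S. (v, x) \<notin> parcs G))"

text \<open>
  The heart of the argument.  On the link of \<open>xs\<close> put \<open>f u = \<phi> (u # xs)\<close>.  Pairs \<open>u\<close>, \<open>v\<close> that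
  extend \<open>xs\<close> to a simplex are all pairs of link vertices but the equal and the adjacent ones.
  The sum over all pairs vanishes since \<open>\<phi>\<close> is coclosed.  The adjacency matrix is \<open>M - excess\<close>;
  \<open>M\<close> contributes with a favourable sign because it is positive semidefinite, and \<open>excess\<close> has
  nonnegative entries, so each mixed term \<open>f u * f v\<close> is bounded by the mean of the two squares.
\<close>
lemma link_pair_bound:
  assumes \<phi>: "\<phi> \<in> cochains K (int n)" and co: "codiff \<phi> xs = 0" and xs: "xs \<in> simplices n"
  shows "(\<Sum>u\<in>pverts G. \<Sum>v\<in>pverts G. if v # u # xs \<in> simplices (Suc (Suc n))
            then w u * w v * \<phi> (u # xs) * \<phi> (v # xs) else 0) \<le>
         (\<Sum>u\<in>pverts G. if u # xs \<in> simplices (Suc n) then w u * (\<phi> (u # xs))\<^sup>2 *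
            ((\<Sum>v\<in>pverts G. in_link (set xs) v * excess u v * w v) - w u) else 0)"
    (is "?L \<le> ?R")
proof -
  let ?V = "pverts G"
  define f where "f = (\<lambda>u. \<phi> (u # xs))"
  define I where "I = in_link (set xs)"
  define A where "A = (\<lambda>u v. of_bool ((u, v) \<in> parcs G) :: real)"
  have I: "I v = of_bool (v # xs \<in> simplices (Suc n))" if "v \<in> ?V" for v
    using that xs by (simp add: I_def in_link_def Cons_simplex_iff)
  have I01: "I v = 0 \<or> I v = 1" for v by (simp add: I_def in_link_def) blast
  have f0: "f v = 0" if "v \<in> ?V" "I v = 0" for v
    using that I cochain_support[OF \<phi>] by (simp add: f_def)
  have split: "(if v # u # xs \<in> simplices (Suc (Suc n))
            then w u * w v * \<phi> (u # xs) * \<phi> (v # xs) else 0) =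
        (w u * f u) * (w v * f v) - (if u = v then (w u * f u) * (w u * f u) else 0)
        - A u v * (w u * f u) * (w v * f v)" if uv: "u \<in> ?V" "v \<in> ?V" for u v
  proof (cases "I u = 1 \<and> I v = 1")
    case True
    then have "u # xs \<in> simplices (Suc n)" "v # xs \<in> simplices (Suc n)"
      using I[OF uv(1)] I[OF uv(2)] by auto
    then have "v # u # xs \<in> simplices (Suc (Suc n)) \<longleftrightarrow> u \<noteq> v \<and> (u, v) \<notin> parcs G"
      using Cons_simplex_iff[OF uv(2)] adj_sym[of u v] by auto
    then show ?thesis using no_loop by (auto simp: f_def A_def)
  next
    case False
    then have "f u = 0 \<or> f v = 0" using I01 f0 uv by blast
    then show ?thesis by (auto simp: f_def)
  qed
  have sum0: "(\<Sum>u\<in>?V. w u * f u) = 0"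
    using co by (simp add: codiff_def f_def)
  have "?L = (\<Sum>u\<in>?V. \<Sum>v\<in>?V. (w u * f u) * (w v * f v) - (if u = v then (w u * f u) * (w u * f u) else 0)
        - A u v * (w u * f u) * (w v * f v))"
    by (intro sum.cong refl split)
  also have "\<dots> = (\<Sum>u\<in>?V. w u * f u) * (\<Sum>v\<in>?V. w v * f v) - (\<Sum>u\<in>?V. (w u * f u) * (w u * f u))
        - (\<Sum>u\<in>?V. \<Sum>v\<in>?V. A u v * (w u * f u) * (w v * f v))"
    using finite_vertices by (simp add: sum_subtractf sum_product)
  also have "\<dots> = - (\<Sum>u\<in>?V. (w u * f u) * (w u * f u))
        - (\<Sum>u\<in>?V. \<Sum>v\<in>?V. A u v * (w u * f u) * (w v * f v))"
    by (simp add: sum0)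
  finally have L: "?L = \<dots>" .
  have "(\<Sum>u\<in>?V. \<Sum>v\<in>?V. A u v * (w u * f u) * (w v * f v)) =
        (\<Sum>u\<in>?V. \<Sum>v\<in>?V. M u v * (w u * f u) * (w v * f v)) -
        (\<Sum>u\<in>?V. \<Sum>v\<in>?V. excess u v * (w u * f u) * (w v * f v))"
    by (simp add: sum_subtractf[symmetric] excess_def A_def algebra_simps)
  then have A_ge: "- (\<Sum>u\<in>?V. \<Sum>v\<in>?V. A u v * (w u * f u) * (w v * f v)) \<le>
        (\<Sum>u\<in>?V. \<Sum>v\<in>?V. excess u v * (w u * f u) * (w v * f v))"
    using M_psd[of "\<lambda>u. w u * f u"] by simp
  define g where "g = (\<lambda>u v. I v * excess u v * w u * w v * (f u)\<^sup>2)"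
  have "(\<Sum>u\<in>?V. \<Sum>v\<in>?V. excess u v * (w u * f u) * (w v * f v)) \<le>
        (\<Sum>u\<in>?V. \<Sum>v\<in>?V. (g u v + g v u) / 2)"
  proof (intro sum_mono)
    fix u v assume uv: "u \<in> ?V" "v \<in> ?V"
    define c where "c = excess u v * w u * w v"
    have "c \<ge> 0" unfolding c_def using excess_nonneg[OF uv] w_pos uv by (simp add: less_imp_le)
    have excess_sym: "excess v u = excess u v" using M_sym[OF uv] adj_sym by (simp add: excess_def)
    have "2 * (f u * f v) \<le> (f u)\<^sup>2 + (f v)\<^sup>2"
      using sum_squares_bound[of "f u" "f v"] by (simp add: mult.assoc)
    then have c: "2 * (c * (f u * f v)) \<le> c * ((f u)\<^sup>2 + (f v)\<^sup>2)"
      using mult_left_mono[OF _ \<open>c \<ge> 0\<close>] by (simp add: mult.left_commute)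
    have g: "g u v = I v * (c * (f u)\<^sup>2)" "g v u = I u * (c * (f v)\<^sup>2)"
      by (simp_all add: g_def c_def excess_sym)
    have g0: "g u v \<ge> 0" "g v u \<ge> 0"
      unfolding g using I01[of u] I01[of v] \<open>c \<ge> 0\<close> by auto
    have "c * (f u * f v) \<le> (g u v + g v u) / 2"
    proof (cases "I u = 1 \<and> I v = 1")
      case True
      then show ?thesis using c by (simp add: g algebra_simps)
    next
      case False
      then have "f u * f v = 0" using I01 f0 uv by (metis mult_eq_0_iff)
      then show ?thesis using g0 by auto
    qed
    then show "excess u v * (w u * f u) * (w v * f v) \<le> (g u v + g v u) / 2"
      by (simp add: c_def mult_ac)
  qed
  also have "\<dots> = (\<Sum>u\<in>?V. \<Sum>v\<in>?V. g u v)"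
  proof -
    have "(\<Sum>u\<in>?V. \<Sum>v\<in>?V. g v u) = (\<Sum>u\<in>?V. \<Sum>v\<in>?V. g u v)" by (rule sum.swap)
    then show ?thesis by (simp add: sum_divide_distrib[symmetric] sum.distrib)
  qed
  finally have "?L \<le> (\<Sum>u\<in>?V. \<Sum>v\<in>?V. g u v) - (\<Sum>u\<in>?V. (w u * f u) * (w u * f u))"
    using L A_ge by simp
  also have "\<dots> = (\<Sum>u\<in>?V. w u * (f u)\<^sup>2 * ((\<Sum>v\<in>?V. I v * excess u v * w v) - w u))"
    by (simp add: sum_subtractf[symmetric] g_def sum_distrib_left power2_eq_square algebra_simps)
  also have "\<dots> = ?R"
    using I f0 by (intro sum.cong refl) (auto simp: f_def I_def)
  finally show ?thesis .
qed

text \<open>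
  Distinguish the number of neighbours of \<open>v\<close> in the simplex \<open>S\<close>.  Without neighbours, all
  links involved contain \<open>v\<close>; with a single neighbour \<open>u\<close>, only the link of \<open>S - {u}\<close> does, and there
  \<open>excess u v\<close> is smaller than \<open>M u v\<close> by exactly the required \<open>1\<close>; with two or more, no
  link contains \<open>v\<close>, but \<open>M\<close> already sums to at least \<open>2\<close>.  If \<open>v \<in> S\<close>, only the link of
  \<open>S - {v}\<close> contributes.
\<close>
lemma vertex_bound:
  assumes S: "S \<in> K" and v: "v \<in> pverts G"
  shows "1 - (\<Sum>u\<in>S. M u v) \<le>
         in_link S v + of_bool (v \<in> S) - (\<Sum>u\<in>S. in_link (S - {u}) v * excess u v)"
proof -
  have finS: "finite S" and SV: "S \<subseteq> pverts G"
    using S simplex_subset finite_vertices finite_subset by blast+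
  have M_nonneg: "M u v \<ge> 0" if "u \<in> S" for u
    using adj_le[of u v] that SV v by (smt (verit) of_bool_def subsetD)
  have indep: "(a, b) \<notin> parcs G" if "a \<in> S" "b \<in> S" for a b
    using S that by (auto simp: independence_complex_def independent_set_def)
  define T where "T = {u \<in> S. (v, u) \<in> parcs G}"
  consider (member) "v \<in> S" | (link) "v \<notin> S" "T = {}" | (one) u where "v \<notin> S" "T = {u}"
    | (many) a b where "v \<notin> S" "a \<in> T" "b \<in> T" "a \<noteq> b"
  proof (cases "v \<in> S \<or> T = {}")
    case False
    then obtain a where a: "v \<notin> S" "a \<in> T" by blast
    show ?thesis
    proof (cases "T = {a}")
      case False
      then obtain b where "b \<in> T" "a \<noteq> b" using a(2) by auto
      then show ?thesis using many a by simp
    qed (use a one in simp)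
  qed (use member link in auto)
  then show ?thesis
  proof cases
    case member
    have "(\<Sum>u\<in>S. in_link (S - {u}) v * excess u v) = (\<Sum>u\<in>{v}. M u v)"
      using finS member indep no_loop by (intro sum.mono_neutral_cong_right) (auto simp: in_link_def excess_def)
    also have "\<dots> \<le> (\<Sum>u\<in>S. M u v)"
      using finS member M_nonneg by (intro sum_mono2) auto
    finally show ?thesis using member by (simp add: in_link_def)
  next
    case link
    then have none: "(v, u) \<notin> parcs G" "(u, v) \<notin> parcs G" if "u \<in> S" for u
      using that adj_sym[of u v] by (auto simp: T_def)
    have "(\<Sum>u\<in>S. in_link (S - {u}) v * excess u v) = (\<Sum>u\<in>S. M u v)"
      using link(1) none by (intro sum.cong) (auto simp: in_link_def excess_def)
    then show ?thesis using link by (auto simp: in_link_def T_def)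
  next
    case (one u)
    then have u: "u \<in> S" "(v, u) \<in> parcs G" and uniq: "\<And>x. x \<in> S \<Longrightarrow> (v, x) \<in> parcs G \<Longrightarrow> x = u"
      by (auto simp: T_def)
    have "in_link (S - {x}) v = of_bool (x = u)" if "x \<in> S" for x
    proof -
      have "(v \<notin> S - {x} \<and> (\<forall>y\<in>S - {x}. (v, y) \<notin> parcs G)) \<longleftrightarrow> x = u"
        using one(1) u uniq by blast
      then show ?thesis by (simp add: in_link_def)
    qed
    then have "(\<Sum>x\<in>S. in_link (S - {x}) v * excess x v) = (\<Sum>x\<in>S. if x = u then excess x v else 0)"
      by (intro sum.cong) auto
    also have "\<dots> = M u v - 1"
      using finS u adj_sym[of u v] by (simp add: excess_def)
    finally have "(\<Sum>x\<in>S. in_link (S - {x}) v * excess x v) = M u v - 1" .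
    moreover have "(\<Sum>x\<in>{u}. M x v) \<le> (\<Sum>x\<in>S. M x v)"
      using finS u M_nonneg by (intro sum_mono2) auto
    ultimately show ?thesis using one u by (auto simp: in_link_def)
  next
    case (many a b)
    then have ab: "a \<in> S" "b \<in> S" "(v, a) \<in> parcs G" "(v, b) \<in> parcs G" by (auto simp: T_def)
    have "(\<Sum>x\<in>S. in_link (S - {x}) v * excess x v) = 0"
      using ab many by (intro sum.neutral) (auto simp: in_link_def)
    moreover have "M a v \<ge> 1" "M b v \<ge> 1"
      using adj_le[of a v] adj_le[of b v] ab SV v adj_sym[of v] by auto
    moreover have "(\<Sum>x\<in>{a, b}. M x v) \<le> (\<Sum>x\<in>S. M x v)"
      using finS ab M_nonneg by (intro sum_mono2) auto
    ultimately show ?thesis using many ab by (auto simp: in_link_def)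
  qed
qed

text \<open>
  The weighted sum of \<open>vertex_bound\<close> over all vertices.
\<close>
lemma simplex_bound:
  assumes S: "S \<in> K"
  shows "(\<Sum>v\<in>pverts G. w v) - (\<Sum>u\<in>S. \<Sum>v\<in>pverts G. M u v * w v) \<le>
     (\<Sum>v\<in>pverts G. in_link S v * w v) -
     (\<Sum>u\<in>S. (\<Sum>v\<in>pverts G. in_link (S - {u}) v * excess u v * w v) - w u)"
proof -
  let ?V = "pverts G"
  have SV: "S \<subseteq> ?V" using S simplex_subset by blast
  have "(\<Sum>v\<in>?V. w v) - (\<Sum>u\<in>S. \<Sum>v\<in>?V. M u v * w v) = (\<Sum>v\<in>?V. (1 - (\<Sum>u\<in>S. M u v)) * w v)"
    by (subst sum.swap) (simp add: left_diff_distrib sum_subtractf sum_distrib_right)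
  also have "\<dots> \<le> (\<Sum>v\<in>?V. (in_link S v + of_bool (v \<in> S) - (\<Sum>u\<in>S. in_link (S - {u}) v * excess u v)) * w v)"
    using w_pos by (intro sum_mono mult_right_mono vertex_bound S) (auto simp: less_imp_le)
  also have "\<dots> = (\<Sum>v\<in>?V. in_link S v * w v) + (\<Sum>v\<in>?V. of_bool (v \<in> S) * w v)
      - (\<Sum>v\<in>?V. \<Sum>u\<in>S. in_link (S - {u}) v * excess u v * w v)"
    by (simp add: distrib_right left_diff_distrib sum.distrib sum_subtractf sum_distrib_right)
  also have "(\<Sum>v\<in>?V. of_bool (v \<in> S) * w v) = (\<Sum>u\<in>S. w u)"
    using finite_vertices SV by (intro sum.mono_neutral_cong_right) auto
  also have "(\<Sum>v\<in>?V. \<Sum>u\<in>S. in_link (S - {u}) v * excess u v * w v) =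
      (\<Sum>u\<in>S. \<Sum>v\<in>?V. in_link (S - {u}) v * excess u v * w v)"
    by (rule sum.swap)
  finally show ?thesis by (simp add: sum_subtractf)
qed

text \<open>
  Combining the bounds on all links: with respect to the measure \<open>weight * \<phi>\<^sup>2\<close> on
  simplices, the weight \<open>\<Sum>\<^sub>u (M w)\<^sub>u\<close> collected along a simplex is on average at least
  the total weight of the graph.
\<close>
lemma harmonic_average:
  assumes \<phi>: "\<phi> \<in> cocycles K (int n)" and co: "\<And>xs. codiff \<phi> xs = 0"
  shows "(\<Sum>xs\<in>simplices (Suc n). weight xs * (\<phi> xs)\<^sup>2 *
           ((\<Sum>v\<in>pverts G. w v) - (\<Sum>u\<in>set xs. \<Sum>v\<in>pverts G. M u v * w v))) \<le> 0"
proof -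
  let ?V = "pverts G" and ?c = "\<lambda>xs. weight xs * (\<phi> xs)\<^sup>2"
  define h where "h = (\<lambda>u S. (\<Sum>v\<in>?V. in_link S v * excess u v * w v) - w u)"
  have \<phi>': "\<phi> \<in> cochains K (int n)" "alternating \<phi>" using \<phi> by (auto simp: cocycles_def cochains_iff)
  have link_sum: "(\<Sum>v\<in>?V. if v # xs \<in> simplices (Suc (Suc n)) then w v else 0) = (\<Sum>v\<in>?V. in_link (set xs) v * w v)"
    if "xs \<in> simplices (Suc n)" for xs
    using that by (intro sum.cong) (auto simp: in_link_def Cons_simplex_iff)
  have "(\<Sum>xs\<in>simplices (Suc n). ?c xs * (\<Sum>v\<in>?V. in_link (set xs) v * w v)) =
        (\<Sum>xs\<in>simplices (Suc n). ?c xs * (\<Sum>v\<in>?V. if v # xs \<in> simplices (Suc (Suc n)) then w v else 0))"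
    by (intro sum.cong) (simp_all add: link_sum)
  also have "\<dots> = real (Suc n) * (\<Sum>xs\<in>simplices n. weight xs *
            (\<Sum>u\<in>?V. \<Sum>v\<in>?V. if v # u # xs \<in> simplices (Suc (Suc n))
               then w u * w v * \<phi> (u # xs) * \<phi> (v # xs) else 0))"
    by (rule harmonic_identity[OF \<phi>])
  also have "\<dots> \<le> real (Suc n) * (\<Sum>xs\<in>simplices n. weight xs *
            (\<Sum>u\<in>?V. if u # xs \<in> simplices (Suc n) then w u * (\<phi> (u # xs))\<^sup>2 * h u (set xs) else 0))"
    unfolding h_def
    by (intro mult_left_mono sum_mono link_pair_bound[OF \<phi>'(1) co])
       (auto intro: less_imp_le weight_simplex_pos)
  also have "\<dots> = (\<Sum>xs\<in>simplices (Suc n). ?c xs * (\<Sum>u\<in>set xs. h u (set xs - {u})))"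
    by (rule sum_pointed_simplices[OF \<phi>'(2)])
  finally have "(\<Sum>xs\<in>simplices (Suc n). ?c xs * ((\<Sum>v\<in>?V. in_link (set xs) v * w v) - (\<Sum>u\<in>set xs. h u (set xs - {u})))) \<le> 0"
    by (simp add: right_diff_distrib sum_subtractf)
  moreover have "(\<Sum>xs\<in>simplices (Suc n). ?c xs * ((\<Sum>v\<in>?V. w v) - (\<Sum>u\<in>set xs. \<Sum>v\<in>?V. M u v * w v))) \<le>
      (\<Sum>xs\<in>simplices (Suc n). ?c xs * ((\<Sum>v\<in>?V. in_link (set xs) v * w v) - (\<Sum>u\<in>set xs. h u (set xs - {u}))))"
    unfolding h_def
    using weight_simplex_pos[of _ "Suc n"]
    by (intro sum_mono mult_left_mono simplex_bound) (auto simp: less_imp_le dest: simplicesD(2))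
  ultimately show ?thesis by linarith
qed

text \<open>
  The reply to \<open>w\<close> in the minimax theorem: normalise \<open>weight * \<phi>\<^sup>2\<close> to a probability measure on
  simplices and let \<open>\<alpha> u\<close> be the probability that a random simplex contains \<open>u\<close>.  The total
  of \<open>\<alpha>\<close> is the number \<open>n + 1\<close> of vertices of a simplex.
\<close>
lemma weighted_response:
  assumes "\<not> cocycles K (int n) \<subseteq> coboundaries K (int n)"
  shows "\<exists>\<alpha>. (\<forall>v\<in>pverts G. \<alpha> v \<ge> 0) \<and> sum \<alpha> (pverts G) = real (Suc n) \<and>
     (\<Sum>v\<in>pverts G. w v) \<le> (\<Sum>v\<in>pverts G. w v * (\<Sum>u\<in>pverts G. \<alpha> u * M u v))"
proof -
  let ?V = "pverts G" and ?X = "simplices (Suc n)"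
  obtain \<phi> where \<phi>: "\<phi> \<in> cocycles K (int n)" "\<phi> \<noteq> (\<lambda>_. 0)" and co: "\<And>xs. codiff \<phi> xs = 0"
    using harmonic_representative[OF assms] by blast
  define c where "c = (\<lambda>xs. weight xs * (\<phi> xs)\<^sup>2)"
  define t where "t = sum c ?X"
  have c0: "c xs \<ge> 0" if "xs \<in> ?X" for xs
    using weight_simplex_pos[OF that] by (simp add: c_def less_imp_le)
  obtain ys where "\<phi> ys \<noteq> 0" using \<phi>(2) by auto
  then have "ys \<in> ?X" using \<phi>(1) cochain_support[of \<phi> n ys] by (auto simp: cocycles_def)
  then have "t > 0"
    unfolding t_def using \<open>\<phi> ys \<noteq> 0\<close> c0 finite_simplices weight_simplex_pos[of ys "Suc n"]
    by (intro sum_pos2[of _ ys]) (auto simp: c_def)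
  define \<alpha> where "\<alpha> = (\<lambda>u. (\<Sum>xs\<in>?X. if u \<in> set xs then c xs else 0) / t)"
  have pair: "(\<Sum>u\<in>?V. \<alpha> u * g u) = (\<Sum>xs\<in>?X. c xs * (\<Sum>u\<in>set xs. g u)) / t" for g
  proof -
    have "(\<Sum>xs\<in>?X. if u \<in> set xs then c xs else 0) * g u =
          (\<Sum>xs\<in>?X. if u \<in> set xs then c xs * g u else 0)" for u
      unfolding sum_distrib_right by (intro sum.cong) auto
    then have "\<alpha> u * g u = (\<Sum>xs\<in>?X. if u \<in> set xs then c xs * g u else 0) / t" for u
      by (simp add: \<alpha>_def)
    then have "(\<Sum>u\<in>?V. \<alpha> u * g u) =
        (\<Sum>u\<in>?V. \<Sum>xs\<in>?X. if u \<in> set xs then c xs * g u else 0) / t"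
      by (simp only: sum_divide_distrib[symmetric])
    also have "(\<Sum>u\<in>?V. \<Sum>xs\<in>?X. if u \<in> set xs then c xs * g u else 0) =
        (\<Sum>xs\<in>?X. \<Sum>u\<in>?V. if u \<in> set xs then c xs * g u else 0)"
      by (rule sum.swap)
    also have "\<dots> = (\<Sum>xs\<in>?X. c xs * (\<Sum>u\<in>set xs. g u))"
    proof (rule sum.cong[OF refl])
      fix xs assume "xs \<in> ?X"
      then have "(\<Sum>u\<in>?V. if u \<in> set xs then c xs * g u else 0) = (\<Sum>u\<in>set xs. c xs * g u)"
        using finite_vertices simplicesD(3) by (intro sum.mono_neutral_cong_right) auto
      then show "(\<Sum>u\<in>?V. if u \<in> set xs then c xs * g u else 0) = c xs * (\<Sum>u\<in>set xs. g u)"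
        by (simp add: sum_distrib_left)
    qed
    finally show ?thesis .
  qed
  have "\<alpha> v \<ge> 0" for v
    unfolding \<alpha>_def using c0 \<open>t > 0\<close> by (auto intro!: divide_nonneg_pos sum_nonneg)
  moreover have "sum \<alpha> ?V = real (Suc n)"
  proof -
    have card: "card (set xs) = Suc n" if "xs \<in> ?X" for xs
      using simplicesD[OF that] by (simp add: distinct_card)
    have "sum \<alpha> ?V = (\<Sum>xs\<in>?X. c xs * real (Suc n)) / t"
      using pair[of "\<lambda>_. 1"] card by simp
    also have "\<dots> = real (Suc n)"
      using \<open>t > 0\<close> by (simp add: t_def sum_distrib_right[symmetric])
    finally show ?thesis .
  qed
  moreover have "(\<Sum>v\<in>?V. w v) \<le> (\<Sum>v\<in>?V. w v * (\<Sum>u\<in>?V. \<alpha> u * M u v))"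
  proof -
    have "(\<Sum>xs\<in>?X. c xs * ((\<Sum>v\<in>?V. w v) - (\<Sum>u\<in>set xs. \<Sum>v\<in>?V. M u v * w v))) \<le> 0"
      unfolding c_def by (rule harmonic_average[OF \<phi>(1) co])
    then have "t * (\<Sum>v\<in>?V. w v) \<le> (\<Sum>xs\<in>?X. c xs * (\<Sum>u\<in>set xs. \<Sum>v\<in>?V. M u v * w v))"
      by (simp add: t_def right_diff_distrib sum_subtractf sum_distrib_right)
    then have "(\<Sum>v\<in>?V. w v) \<le> (\<Sum>u\<in>?V. \<alpha> u * (\<Sum>v\<in>?V. M u v * w v))"
      unfolding pair using \<open>t > 0\<close> by (simp add: pos_le_divide_eq mult.commute)
    also have "\<dots> = (\<Sum>u\<in>?V. \<Sum>v\<in>?V. w v * (\<alpha> u * M u v))"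
      by (simp add: sum_distrib_left mult_ac)
    also have "\<dots> = (\<Sum>v\<in>?V. w v * (\<Sum>u\<in>?V. \<alpha> u * M u v))"
      by (subst sum.swap) (simp add: sum_distrib_left)
    finally show ?thesis .
  qed
  ultimately show ?thesis by blast
qed

end

section \<open>The inequality\<close>

lemma gram_positive_semidefinite:
  fixes P :: "'a \<Rightarrow> real vec"
  assumes "\<And>v. v \<in> V \<Longrightarrow> P v \<in> carrier_vec l"
  shows "(\<Sum>u\<in>V. \<Sum>v\<in>V. (P u \<bullet> P v) * x u * x v) \<ge> 0"
proof -
  have "(\<Sum>u\<in>V. \<Sum>v\<in>V. (P u \<bullet> P v) * x u * x v) =
      (\<Sum>u\<in>V. \<Sum>v\<in>V. \<Sum>i<l. (x u * P u $ i) * (x v * P v $ i))"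
    using carrier_vecD[OF assms]
    by (simp add: scalar_prod_def sum_distrib_left sum_distrib_right lessThan_atLeast0 mult_ac)
  also have "\<dots> = (\<Sum>u\<in>V. \<Sum>i<l. \<Sum>v\<in>V. (x u * P u $ i) * (x v * P v $ i))"
    by (intro sum.cong refl sum.swap)
  also have "\<dots> = (\<Sum>i<l. \<Sum>u\<in>V. \<Sum>v\<in>V. (x u * P u $ i) * (x v * P v $ i))"
    by (rule sum.swap)
  also have "\<dots> = (\<Sum>i<l. (\<Sum>u\<in>V. x u * P u $ i)\<^sup>2)"
    by (simp add: power2_eq_square sum_product)
  finally show ?thesis by (simp add: sum_nonneg)
qed

text \<open>
  The value is an infimum, so it suffices to come within every \<open>e\<close> of the bound: a mixture with
  \<open>\<alpha> P P\<^sup>T \<ge> 1 - d\<close> becomes feasible on division by \<open>1 - d\<close>.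
\<close>
lemma representation_value_le:
  assumes G: "pair_graph G" and P: "vector_representation G l P"
    and H: "\<not> cocycles (independence_complex G) (int n) \<subseteq> coboundaries (independence_complex G) (int n)"
  shows "representation_value G P \<le> ereal (real n + 1)"
proof (rule ereal_le_epsilon2)
  fix e :: real assume "e > 0"
  interpret pair_graph G by (rule G)
  let ?V = "pverts G"
  define s where "s = real (Suc n)"
  \<comment> \<open>Chosen so that the total \<open>s / (1 - d)\<close> after rescaling is \<open>s + e\<close>.\<close>
  define d where "d = e / (s + e)"
  have "s > 0" by (simp add: s_def)
  have d: "d > 0" "1 - d > 0" "s / (1 - d) = s + e"
    using \<open>e > 0\<close> \<open>s > 0\<close> by (auto simp: d_def field_simps)
  have carrier: "P v \<in> carrier_vec l" if "v \<in> ?V" for v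
    using P that by (simp add: vector_representation_def)
  have "\<exists>\<alpha>. (\<forall>v\<in>?V. \<alpha> v \<ge> 0) \<and> sum \<alpha> ?V = s \<and> (\<forall>v\<in>?V. (\<Sum>u\<in>?V. \<alpha> u * (P u \<bullet> P v)) \<ge> 1 - d)"
  proof (rule approximate_minimax)
    fix w :: "'a \<Rightarrow> real" assume w: "\<And>v. v \<in> ?V \<Longrightarrow> w v > 0"
    interpret weighted_representation G "\<lambda>u v. P u \<bullet> P v" w
    proof unfold_locales
      show "of_bool ((u, v) \<in> parcs G) \<le> P u \<bullet> P v" if "u \<in> ?V" "v \<in> ?V" for u v
        using P that by (auto simp: vector_representation_def)
      show "P u \<bullet> P v = P v \<bullet> P u" if "u \<in> ?V" "v \<in> ?V" for u v
        using comm_scalar_prod carrier that by blast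
    qed (use w carrier gram_positive_semidefinite in blast)+
    show "\<exists>\<alpha>. (\<forall>v\<in>?V. \<alpha> v \<ge> 0) \<and> sum \<alpha> ?V = s \<and>
        sum w ?V \<le> (\<Sum>v\<in>?V. w v * (\<Sum>u\<in>?V. \<alpha> u * (P u \<bullet> P v)))"
      unfolding s_def by (rule weighted_response[OF H])
  qed (use \<open>s > 0\<close> d in auto)
  then obtain \<alpha> where \<alpha>: "\<And>v. v \<in> ?V \<Longrightarrow> \<alpha> v \<ge> 0" "sum \<alpha> ?V = s"
      "\<And>v. v \<in> ?V \<Longrightarrow> (\<Sum>u\<in>?V. \<alpha> u * (P u \<bullet> P v)) \<ge> 1 - d" by blast
  define \<beta> where "\<beta> = (\<lambda>v. \<alpha> v / (1 - d))"
  have "sum \<beta> ?V = s + e"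
    using \<alpha>(2) d(3) by (simp add: \<beta>_def sum_divide_distrib[symmetric])
  moreover have "\<beta> v \<ge> 0" if "v \<in> ?V" for v
    using \<alpha>(1)[OF that] d by (simp add: \<beta>_def)
  moreover have "(\<Sum>v\<in>?V. \<beta> v * (P v \<bullet> P u)) \<ge> 1" if "u \<in> ?V" for u
  proof -
    have "(\<Sum>v\<in>?V. \<beta> v * (P v \<bullet> P u)) = (\<Sum>v\<in>?V. \<alpha> v * (P v \<bullet> P u)) / (1 - d)"
      by (simp add: \<beta>_def sum_divide_distrib)
    then show ?thesis using \<alpha>(3)[OF that] d by simp
  qed
  ultimately have "representation_value G P \<le> ereal (sum \<beta> ?V)"
    unfolding representation_value_def by (intro Inf_lower) blast
  then show "representation_value G P \<le> ereal (real n + 1) + ereal e"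
    using \<open>sum \<beta> ?V = s + e\<close> by (simp add: s_def algebra_simps)
qed

lemma representation_value_empty:
  assumes "pverts G = {}"
  shows "representation_value G P \<le> 0"
  unfolding representation_value_def by (rule Inf_lower) (simp add: assms zero_ereal_def)

text \<open>
  Below degree \<open>-1\<close> no list has the required length.  In degree \<open>-1\<close> a cochain is a number at
  the empty simplex, and its coboundary takes that value at every vertex.
\<close>
lemma cohomology_trivial_below:
  assumes "i < - 1 \<or> (i = - 1 \<and> pverts G \<noteq> {})" and "pair_graph G"
  shows "cocycles (independence_complex G) i = {\<lambda>_. 0}"
proof -
  let ?K = "independence_complex G"
  interpret pair_graph G by (rule assms(2))
  have "\<phi> xs = 0" if \<phi>: "\<phi> \<in> cocycles ?K i" for \<phi> xs
  proof (rule ccontr)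
    assume "\<phi> xs \<noteq> 0"
    then have "int (length xs) = i + 1" using \<phi> by (auto simp: cocycles_def cochains_iff)
    then have "xs = []" "i = -1" using assms(1) by auto
    then obtain v where v: "v \<in> pverts G" using assms(1) by auto
    have "ordered_simplex ?K [v]"
      using v no_loops'
      by (auto simp: ordered_simplex_def independence_complex_def independent_set_def)
    then have "coboundary ?K \<phi> [v] = \<phi> []" by (simp add: coboundary_eq)
    then show False using \<phi> \<open>\<phi> xs \<noteq> 0\<close> \<open>xs = []\<close> by (simp add: cocycles_def)
  qed
  then have "cocycles ?K i \<subseteq> {\<lambda>_. 0}" by blast
  then show ?thesis using cocycles_zero by blast
qed

text \<open>
  Only degrees from \<open>0\<close> on need the spectral argument.  In degree \<open>-1\<close> nontrivial cohomology
  forces the graph to be empty, and then the empty assignment is feasible with value \<open>0\<close>.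
\<close>
lemma nontrivial_cohomology_bound:
  assumes G: "pair_graph G" and P: "vector_representation G l P"
    and nontriv: "\<not> trivial_group (reduced_cohomology (independence_complex G) i)"
  shows "representation_value G P \<le> ereal (real_of_int i) + 1"
proof -
  let ?K = "independence_complex G"
  interpret pair_graph G by (rule G)
  interpret weighted_complex ?K "pverts G" "\<lambda>_. 1"
    by unfold_locales (auto simp: independence_complex_def independent_set_def)
  consider (low) "i < - 1 \<or> (i = - 1 \<and> pverts G \<noteq> {})" | (empty) "i = - 1" "pverts G = {}"
    | (pos) n where "i = int n" proof (cases "i \<ge> 0")
    case True
    then show ?thesis using pos[of "nat i"] by simp
  next
    case False
    then show ?thesis using low empty by fastforce
  qed
  then show ?thesis
  proof cases
    case low
    have "trivial_group (reduced_cohomology ?K i)"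
    proof (rule trivial_cohomologyI)
      show "cocycles ?K i \<subseteq> coboundaries ?K i"
        using cohomology_trivial_below[OF low G] coboundaries_zero by auto
      have "cochains ?K (i - 1) = {\<lambda>_. 0}"
        using low cochains_zero by (auto simp: cochains_iff fun_eq_iff)
      then show "coboundaries ?K i \<subseteq> cocycles ?K i"
        using cocycles_zero by (auto simp: coboundaries_def coboundary_def cong: if_cong)
    qed
    then show ?thesis using nontriv by blast
  next
    case empty
    then show ?thesis using representation_value_empty[of G P] by (simp add: zero_ereal_def)
  next
    case (pos n)
    have "\<not> cocycles ?K (int n) \<subseteq> coboundaries ?K (int n)"
      using trivial_cohomologyI[OF _ coboundaries_subset_cocycles] nontriv pos by blast
    then show ?thesis using representation_value_le[OF G P] pos by simp
  qed
qed

theorem theorem1p3: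
  fixes G :: "'a pair_pre_digraph"
  assumes "pair_graph G"
  shows "eta_complex (independence_complex G) \<ge> Gamma_graph G"
proof -
  let ?N = "{i. \<not> trivial_group (reduced_cohomology (independence_complex G) i)}"
  have "representation_value G P \<le> (INF i\<in>?N. ereal (real_of_int i)) + 1"
    if "vector_representation G l P" for l P
  proof -
    have "representation_value G P - 1 \<le> (INF i\<in>?N. ereal (real_of_int i))"
      using nontrivial_cohomology_bound[OF assms that]
      by (intro INF_greatest) (auto simp: ereal_minus_le_iff add.commute)
    then show ?thesis by (simp add: ereal_minus_le_iff add.commute)
  qed
  then show ?thesis
    unfolding Gamma_graph_def eta_complex_def by (intro Sup_least) blast
qed

end
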